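(* Let $d\ge 2$, let $M$ be a $d\times d$ real matrix all of whose eigenvalues are less than $1$ in modulus, and let $u\in\mathbb{R}^d$ be a cyclic vector for $M$. If $$|\det M|\ge 2^{-1/d},$$ then the attractor $A_M$ of the iterated function system $\{v\mapsto Mv-u,\ v\mapsto Mv+u\}$ has non-empty interior in $\mathbb{R}^d$. In particular, $A_M$ has non-empty interior when each eigenvalue of $M$ is greater than $2^{-1/d^2}$ in modulus.
   Context: A vector $u\in\mathbb{R}^d$ is cyclic for $M$ if $\operatorname{span}\{M^n u\mid n\ge 0\}=\mathbb{R}^d$. The attractor is $$A_M=\Big\{\sum_{k=0}^\infty a_kM^ku \;\Big|\; a_k\in\{-1,1\}\text{ for all }k\ge 0\Big\}.$$ The iterated function system is assumed non-degenerate, i.e. $A_M$ does not lie in any $(d-1)$-dimensional subspace of $\mathbb{R}^d$ (that is, $A_M$ spans $\mathbb{R}^d$). *)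

theory Defs
  imports "HOL-Analysis.Analysis"
begin

text \<open>Complex eigenvalues of a real matrix.\<close>

definition eigenvalue :: "real^'n^'n \<Rightarrow> complex \<Rightarrow> bool" where
  "eigenvalue M z \<longleftrightarrow>
     (\<exists>v :: complex^'n. v \<noteq> 0 \<and> map_matrix complex_of_real M *v v = z *s v)"

definition orbit :: "real^'n^'n \<Rightarrow> real^'n \<Rightarrow> nat \<Rightarrow> real^'n" where
  "orbit M u k = ((\<lambda>v. M *v v) ^^ k) u"

definition cyclic :: "real^'n^'n \<Rightarrow> real^'n \<Rightarrow> bool" where
  "cyclic M u \<longleftrightarrow> span (range (orbit M u)) = UNIV"

text \<open>
  The series below converge whenever all eigenvalues of \<open>M\<close> have modulus less than 1; for other
  \<open>M\<close> the value of a divergent series is unspecified.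
\<close>

definition attractor :: "real^'n^'n \<Rightarrow> real^'n \<Rightarrow> (real^'n) set" where
  "attractor M u =
     {(\<Sum>k. a k *\<^sub>R orbit M u k) | a :: nat \<Rightarrow> real. \<forall>k. a k \<in> {-1, 1}}"

text \<open>
  Cyclicity of \<open>u\<close> already makes the iterated function system non-degenerate, so non-degeneracy
  need not be assumed separately.
\<close>

lemma cyclic_imp_nondegenerate:
  assumes "cyclic M u" and "summable (\<lambda>k. norm (orbit M u k))"
  shows "span (attractor M u) = UNIV"
proof -
  have sm: "summable (\<lambda>k. a k *\<^sub>R orbit M u k)" if "\<forall>k. a k \<in> {-1, 1}" for a :: "nat \<Rightarrow> real"
  proof (rule summable_norm_cancel)
    have "\<bar>a k\<bar> = 1" for k
      using that[rule_format, of k] by auto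
    then show "summable (\<lambda>k. norm (a k *\<^sub>R orbit M u k))"
      using assms(2) by simp
  qed
  have "orbit M u n \<in> span (attractor M u)" for n
  proof -
    define a b :: "nat \<Rightarrow> real" where "a = (\<lambda>_. 1)" and "b = (\<lambda>k. if k = n then -1 else 1)"
    have a: "\<forall>k. a k \<in> {-1, 1}" and b: "\<forall>k. b k \<in> {-1, 1}"
      by (auto simp: a_def b_def)
    have "(\<Sum>k. a k *\<^sub>R orbit M u k) - (\<Sum>k. b k *\<^sub>R orbit M u k)
        = (\<Sum>k. a k *\<^sub>R orbit M u k - b k *\<^sub>R orbit M u k)"
      using suminf_diff[OF sm[OF a] sm[OF b]] .
    also have "\<dots> = (\<Sum>k. if k = n then 2 *\<^sub>R orbit M u k else 0)"
      by (intro suminf_cong) (auto simp: a_def b_def scaleR_2)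
    also have "\<dots> = 2 *\<^sub>R orbit M u n"
      using sums_unique[OF sums_single[of n "\<lambda>k. 2 *\<^sub>R orbit M u k"]] by simp
    finally have eq: "(\<Sum>k. a k *\<^sub>R orbit M u k) - (\<Sum>k. b k *\<^sub>R orbit M u k) = 2 *\<^sub>R orbit M u n" .
    have "(\<Sum>k. a k *\<^sub>R orbit M u k) \<in> attractor M u" "(\<Sum>k. b k *\<^sub>R orbit M u k) \<in> attractor M u"
      using a b unfolding attractor_def by blast+
    then have "2 *\<^sub>R orbit M u n \<in> span (attractor M u)"
      unfolding eq[symmetric] by (intro span_diff span_base)
    from span_scale[OF this, of "1/2"] show ?thesis by simp
  qed
  then have "span (range (orbit M u)) \<subseteq> span (attractor M u)"
    by (intro span_minimal) auto
  then show ?thesis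
    using assms(1) unfolding cyclic_def by auto
qed

end

theory Submission
  imports Defs "HOL-Computational_Algebra.Fundamental_Theorem_Algebra"
begin

text \<open>
  Put \<open>T = M\<^sup>d\<close>, so that \<open>\<bar>det T\<bar> \<ge> 1 / 2\<close>. A compact convex set \<open>C\<close> mapped into its own interior by
  \<open>v \<mapsto> T v \<plusminus> u\<close> must have intersecting images, since otherwise the measure would not decrease.
  Hence all the iterates of \<open>C\<close> are path connected, and each of them contains a path with endpoints
  \<open>2 u\<close> apart. Applying \<open>M\<^sup>j\<close> for \<open>j < d\<close> gives \<open>d\<close> paths whose displacements form a basis, because
  \<open>u\<close> is cyclic. By Brouwer's fixed point theorem the translates of the sum of these paths by the
  lattice spanned by the displacements cover space, finitely many of them (independently of the
  iterate) covering the unit ball. The sums of paths approach \<open>A\<^sub>M = A\<^sub>T + M A\<^sub>T + \<dots> + M ^ (d - 1) A\<^sub>T\<close>, so finitely many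
  translates of the compact set \<open>A\<^sub>M\<close> cover the unit ball, and \<open>A\<^sub>M\<close> has an interior point.

  As \<open>u\<close> is cyclic, the monic polynomial of degree \<open>d\<close> annihilating \<open>u\<close> has only eigenvalues as its
  roots and \<open>\<plusminus> det M\<close> as its constant term. This gives both the summability of the orbits and the
  second criterion.
\<close>

section \<open>The iterated function system\<close>

text \<open>The Hutchinson operator of the two maps, acting on sets so that it can be iterated with
  \<open>^^\<close>.\<close>

definition ifs :: "('a::real_vector \<Rightarrow> 'a) \<Rightarrow> 'a \<Rightarrow> 'a set \<Rightarrow> 'a set" where
  "ifs T u S = (\<lambda>x. T x + u) ` S \<union> (\<lambda>x. T x - u) ` S"

lemma ifs_mono: "S \<subseteq> S' \<Longrightarrow> ifs T u S \<subseteq> ifs T u S'"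
  by (auto simp: ifs_def)

lemma linear_funpow:
  fixes f :: "'a::real_vector \<Rightarrow> 'a"
  assumes "linear f"
  shows "linear (f ^^ k)"
proof (induction k)
  case 0
  show ?case by (simp add: linear_iff)
next
  case (Suc k)
  then show ?case using linear_compose[OF Suc assms] by (simp add: o_def)
qed

text \<open>\<open>N\<close> is a norm adapted to \<open>T\<close>: shifting the series gives
  \<open>N (T x) = N x - norm x\<close>, and as \<open>N x \<le> c * norm x\<close>, the map
  \<open>T\<close> contracts \<open>N\<close> by the factor \<open>1 - 1 / c\<close>. A large enough
  \<open>N\<close>-ball is then mapped into its interior.\<close>

lemma absorbing_set:
  fixes T :: "'a::euclidean_space \<Rightarrow> 'a"
  assumes "linear T" and sm: "\<And>x. summable (\<lambda>k. norm ((T ^^ k) x))"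
  obtains C where "compact C" "convex C" "C \<noteq> {}" "ifs T u C \<subseteq> interior C"
proof -
  define N where "N x = (\<Sum>k. norm ((T ^^ k) x))" for x
  have lin: "linear (T ^^ k)" for k
    using assms(1) by (rule linear_funpow)
  have N_add: "N (x + y) \<le> N x + N y" for x y
    unfolding N_def suminf_add[OF sm sm]
    by (intro suminf_le sm summable_add) (simp add: linear_add[OF lin] norm_triangle_ineq)
  have N_scale: "N (c *\<^sub>R x) = \<bar>c\<bar> * N x" for c x
    unfolding N_def by (simp add: linear_scale[OF lin] suminf_mult sm)
  have N_ge: "norm x \<le> N x" for x
    using sum_le_suminf[OF sm, of "{0}" x] by (simp add: N_def)
  have N_step: "N (T x) = N x - norm x" for x
    using suminf_split_head[OF sm, of x] by (simp add: N_def funpow_swap1)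
  \<comment> \<open>Expansion in the basis bounds \<open>N x\<close> by \<open>norm x\<close> times
    the sum of the \<open>N b\<close>. The summand 1 ensures \<open>c - 1 \<ge> 0\<close>, which the
    final estimate uses.\<close>
  define c where "c = 1 + (\<Sum>b\<in>Basis. N b)"
  have N_nonneg: "0 \<le> N x" for x
    using N_ge[of x] norm_ge_zero order_trans by blast
  have N_sum: "N (sum g A) \<le> (\<Sum>a\<in>A. N (g a))" if "finite A" for g :: "'a \<Rightarrow> 'a" and A
    using that
  proof (induction A rule: finite_induct)
    case empty
    show ?case using N_scale[of 0 0] by simp
  next
    case (insert a A)
    then show ?case using N_add[of "g a" "sum g A"] by simp
  qed
  have c: "c \<ge> 1" by (simp add: c_def sum_nonneg N_nonneg)
  have N_le: "N x \<le> c * norm x" for x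
  proof -
    have "N x = N (\<Sum>b\<in>Basis. (x \<bullet> b) *\<^sub>R b)" by (simp add: euclidean_representation)
    also have "\<dots> \<le> (\<Sum>b\<in>Basis. N ((x \<bullet> b) *\<^sub>R b))" by (rule N_sum) simp
    also have "\<dots> \<le> (\<Sum>b\<in>Basis. norm x * N b)"
      by (intro sum_mono) (simp add: N_scale mult_right_mono Basis_le_norm N_nonneg)
    also have "\<dots> \<le> c * norm x"
      by (simp add: c_def sum_distrib_left distrib_left mult.commute[of _ "norm x"])
    finally show ?thesis .
  qed
  have conv: "convex_on UNIV N"
  proof (rule convex_onI)
    fix t :: real and x y :: 'a
    assume "0 < t" "t < 1"
    then show "N ((1 - t) *\<^sub>R x + t *\<^sub>R y) \<le> (1 - t) * N x + t * N y"
      using N_add[of "(1 - t) *\<^sub>R x" "t *\<^sub>R y"] by (simp add: N_scale)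
  qed simp
  then have cont: "continuous_on UNIV N"
    by (rule convex_on_continuous[OF open_UNIV])
  \<comment> \<open>The estimate needed is \<open>(1 - 1 / c) * R + N u < R\<close>, that is,
    \<open>R > c * N u\<close>.\<close>
  define R where "R = c * (N u + 1)"
  define C where "C = {x. N x \<le> R}"
  have "closed C"
    unfolding C_def by (intro closed_Collect_le cont continuous_on_const)
  moreover have "bounded C"
    unfolding bounded_iff C_def using N_ge order_trans by blast
  ultimately have "compact C" by (simp add: compact_eq_bounded_closed)
  moreover have "convex C"
  proof -
    have "N ((1 - t) *\<^sub>R x + t *\<^sub>R y) \<le> R" if "N x \<le> R" "N y \<le> R" "0 \<le> t" "t \<le> 1" for t x y
    proof -
      have "N ((1 - t) *\<^sub>R x + t *\<^sub>R y) \<le> (1 - t) * N x + t * N y"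
        using N_add[of "(1 - t) *\<^sub>R x" "t *\<^sub>R y"] that by (simp add: N_scale)
      also have "\<dots> \<le> R" by (rule convex_bound_le) (use that in auto)
      finally show ?thesis .
    qed
    then show ?thesis by (auto simp: convex_alt C_def)
  qed
  moreover have "0 \<in> C"
    using N_scale[of 0 0] c N_nonneg[of u] by (simp add: C_def R_def)
  moreover have "ifs T u C \<subseteq> interior C"
  proof -
    have open_lt: "open {x. N x < R}"
      by (intro open_Collect_less cont continuous_on_const)
    have *: "N (T x + v) < R" if x: "N x \<le> R" and v: "N v = N u" for x v
    proof -
      have "c * N (T x + v) \<le> c * (N x - norm x + N u)"
        using N_add[of "T x" v] c v by (simp add: N_step)
      also have "\<dots> \<le> (c - 1) * N x + c * N u"
        using N_le[of x] by (simp add: algebra_simps)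
      also have "\<dots> \<le> (c - 1) * R + c * N u"
        using x c by (simp add: mult_left_mono)
      also have "\<dots> < c * R"
        using c by (simp add: R_def algebra_simps)
      finally show ?thesis using c by simp
    qed
    have "N (- u) = N u" using N_scale[of "-1" u] by simp
    then have "ifs T u C \<subseteq> {x. N x < R}"
      using *[of _ u] *[of _ "- u"] by (auto simp: ifs_def C_def)
    also have "\<dots> \<subseteq> interior C"
      by (rule interior_maximal[OF _ open_lt]) (auto simp: C_def)
    finally show ?thesis .
  qed
  ultimately show ?thesis using that by blast
qed

lemma compact_ifs:
  fixes T :: "'a::euclidean_space \<Rightarrow> 'a"
  assumes "linear T" "compact S"
  shows "compact (ifs T u S)"
  unfolding ifs_def using assms
  by (intro compact_Un compact_continuous_image continuous_intros)
     (auto simp: linear_continuous_on linear_conv_bounded_linear)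

text \<open>If the two images were disjoint, then \<open>ifs T u C\<close> would have at least the measure of \<open>C\<close>, so
  \<open>interior C\<close> would coincide with the compact set \<open>ifs T u C\<close>.\<close>

lemma ifs_images_intersect_wellorder:
  fixes T :: "real^'n::{finite,wellorder} \<Rightarrow> real^'n::_"
  assumes T: "linear T" and det: "\<bar>det (matrix T)\<bar> \<ge> 1 / 2"
    and C: "compact C" "C \<noteq> {}" and sub: "ifs T u C \<subseteq> interior C"
  shows "(\<lambda>x. T x + u) ` C \<inter> (\<lambda>x. T x - u) ` C \<noteq> {}"
proof
  assume disj: "(\<lambda>x. T x + u) ` C \<inter> (\<lambda>x. T x - u) ` C = {}"
  let ?\<mu> = "measure lebesgue"
  have C_meas: "C \<in> lmeasurable" using C(1) by (rule lmeasurable_compact)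
  have TC: "T ` C \<in> lmeasurable" using T C_meas by (rule measurable_linear_image)
  have im: "(\<lambda>x. T x + u) ` C = (+) u ` T ` C" "(\<lambda>x. T x - u) ` C = (\<lambda>x. x - u) ` T ` C"
    by (auto simp: image_image add.commute)
  have "?\<mu> (ifs T u C) = ?\<mu> ((\<lambda>x. T x + u) ` C) + ?\<mu> ((\<lambda>x. T x - u) ` C)"
    unfolding ifs_def
    using measure_Un3[of "(\<lambda>x. T x + u) ` C" lebesgue "(\<lambda>x. T x - u) ` C"] disj
    by (simp add: im TC measurable_translation measurable_translation_subtract)
  also have "\<dots> = 2 * \<bar>det (matrix T)\<bar> * ?\<mu> C"
    unfolding im by (simp add: measure_translation measure_translation_subtract
        measure_linear_image[OF T C_meas])
  finally have "?\<mu> (ifs T u C) \<ge> ?\<mu> C"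
    using det mult_right_mono[of "1" "2 * \<bar>det (matrix T)\<bar>" "?\<mu> C"] by simp
  moreover have D: "compact (ifs T u C)" using T C(1) by (rule compact_ifs)
  moreover have int: "interior C \<in> lmeasurable"
    using C(1) by (simp add: lmeasurable_interior compact_imp_bounded)
  moreover have "?\<mu> (interior C) \<le> ?\<mu> C"
    using interior_subset int C_meas by (intro measure_mono_fmeasurable) (auto simp: fmeasurableD)
  \<comment> \<open>Since \<open>interior C\<close> has at most the measure of \<open>C\<close>,
    which is at most that of its subset \<open>ifs T u C\<close>, nothing of positive measure is
    left over.\<close>
  ultimately have "?\<mu> (interior C - ifs T u C) \<le> 0"
    using measurable_measure_Diff[OF int, of "ifs T u C"] sub
    by (simp add: lmeasurable_compact fmeasurableD)
  then have "?\<mu> (interior C - ifs T u C) = 0"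
    by (simp add: measure_le_0_iff)
  then have "negligible (interior C - ifs T u C)"
    using int D by (simp add: negligible_iff_measure lmeasurable_compact fmeasurable.Diff fmeasurableD)
  moreover have "open (interior C - ifs T u C)"
    using D by (simp add: compact_imp_closed open_Diff)
  ultimately have "interior C = ifs T u C"
    using open_not_negligible sub by blast
  then have "closed (interior C)" "bounded (interior C)"
    using D by (simp_all add: compact_imp_closed compact_imp_bounded)
  \<comment> \<open>A clopen set is empty or the whole space, and boundedness excludes the
    latter.\<close>
  then have "interior C = {}"
    using clopen[of "interior C"] not_bounded_UNIV by auto
  then show False using sub C(2) by (auto simp: ifs_def)
qed


section \<open>Transfer of the measure argument to arbitrary finite index types\<close>

text \<open>Conjugation of \<open>p\<close> to \<open>h \<circ> p \<circ> inv h\<close> is a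
  sign-preserving bijection between the permutations of the two index types; it matches the terms of
  the two Leibniz sums.\<close>

lemma det_reindex:
  fixes A :: "'a::comm_ring_1^'n^'n" and h :: "'m::finite \<Rightarrow> 'n"
  assumes h: "bij h"
  shows "det (\<chi> i j. A $ h i $ h j) = det A"
proof -
  let ?c = "map_permutation UNIV h" and ?d = "map_permutation UNIV (inv h)"
  have c: "?c p = h \<circ> p \<circ> inv h" for p
    using h by (auto simp: map_permutation_def bij_def fun_eq_iff)
  have surj: "surj (inv h)" "inj (inv h)" using bij_imp_bij_inv[OF h] by (auto simp: bij_def)
  have d: "?d p = inv h \<circ> p \<circ> h" for p
    using surj h by (simp add: map_permutation_def inv_inv_eq restrict_id_def o_def)
  have perm: "q permutes UNIV \<longleftrightarrow> bij q" for q :: "'b \<Rightarrow> 'b"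
    by (simp add: permutes_univ bij_iff)
  have prod: "(\<Prod>i\<in>UNIV. A $ h i $ h (p i)) = (\<Prod>i\<in>UNIV. A $ i $ ?c p i)" for p
    by (rule prod.reindex_bij_witness[of _ "inv h" h]) (use h in \<open>auto simp: c bij_def surj_f_inv_f\<close>)
  show ?thesis
    unfolding det_def
  proof (rule sum.reindex_bij_witness[of _ ?d ?c])
    fix p :: "'m \<Rightarrow> 'm"
    assume "p \<in> {p. p permutes UNIV}"
    then have p: "p permutes UNIV" by simp
    then show "?c p \<in> {p. p permutes UNIV}"
      using h by (simp add: c perm bij_comp bij_imp_bij_inv)
    show "?d (?c p) = p"
      using h by (simp add: c d fun_eq_iff bij_is_inj)
    have "sign (?c p) = sign p"
      using h p by (intro sign_map_permutation) (auto simp: bij_def)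
    then show "of_int (sign (?c p)) * (\<Prod>i\<in>UNIV. A $ i $ ?c p i) =
        of_int (sign p) * (\<Prod>i\<in>UNIV. (\<chi> i j. A $ h i $ h j) $ i $ p i)"
      by (simp add: prod)
  next
    fix p :: "'n \<Rightarrow> 'n"
    assume "p \<in> {p. p permutes UNIV}"
    then show "?d p \<in> {p. p permutes UNIV}"
      using h by (simp add: d perm bij_comp bij_imp_bij_inv)
    show "?c (?d p) = p"
      using h by (simp add: c d fun_eq_iff bij_is_surj surj_f_inv_f)
  qed
qed

text \<open>The library states the measure of a linear image only for well-ordered index types.\<close>

typedef 'a wellordered = "UNIV :: 'a set"
  morphisms unorder wellorder
  by simp

lemma bij_unorder: "bij unorder"
  by (metis bijI' unorder_inject wellorder_inverse UNIV_I)

instance wellordered :: (finite) finite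
proof
  show "finite (UNIV :: 'a wellordered set)"
    unfolding bij_betw_finite[OF bij_unorder] by (rule finite_class.finite_UNIV)
qed

instantiation wellordered :: (finite) wellorder
begin

text \<open>The order is pulled back along the injection \<open>to_nat\<close>, as finite types are
  countable.\<close>

definition less_eq_wellordered :: "'a wellordered \<Rightarrow> 'a wellordered \<Rightarrow> bool" where
  "x \<le> y \<longleftrightarrow> to_nat (unorder x) \<le> to_nat (unorder y)"

definition less_wellordered :: "'a wellordered \<Rightarrow> 'a wellordered \<Rightarrow> bool" where
  "x < y \<longleftrightarrow> to_nat (unorder x) < to_nat (unorder y)"

instance
proof
  fix P :: "'a wellordered \<Rightarrow> bool" and a
  assume step: "\<And>x. (\<And>y. y < x \<Longrightarrow> P y) \<Longrightarrow> P x"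
  show "P a"
  proof (induction a rule: measure_induct_rule[of "\<lambda>x. to_nat (unorder x)"])
    case (less x)
    then show ?case using step by (simp add: less_wellordered_def)
  qed
qed (auto simp: less_eq_wellordered_def less_wellordered_def unorder_inject)

end

lemma ifs_linear_conjugate:
  assumes "linear R" "\<And>x. R' (R x) = x"
  shows "ifs (\<lambda>x. R (T (R' x))) (R u) (R ` S) = R ` ifs T u S"
  by (simp add: ifs_def image_Un image_image assms linear_add linear_diff)

text \<open>Renaming coordinates by \<open>R\<close> is a linear isomorphism onto the space with
  well-ordered indices. It preserves determinants, compactness and interiors, so the well-ordered
  case applies to the conjugate \<open>T'\<close>.\<close>

proposition ifs_images_intersect:
  fixes T :: "real^'n \<Rightarrow> real^'n"
  assumes T: "linear T" and det: "\<bar>det (matrix T)\<bar> \<ge> 1 / 2"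
    and C: "compact C" "C \<noteq> {}" and sub: "ifs T u C \<subseteq> interior C"
  shows "(\<lambda>x. T x + u) ` C \<inter> (\<lambda>x. T x - u) ` C \<noteq> {}"
proof -
  define R :: "real^'n \<Rightarrow> real^'n wellordered" where "R x = (\<chi> i. x $ unorder i)" for x
  define R' :: "real^'n wellordered \<Rightarrow> real^'n" where "R' x = (\<chi> i. x $ wellorder i)" for x
  have lin: "linear R" "linear R'" by (auto simp: R_def R'_def linear_iff vec_eq_iff)
  have inv: "R' (R x) = x" "R (R' y) = y" for x y
    by (auto simp: R_def R'_def vec_eq_iff wellorder_inverse unorder_inverse)
  have bij: "bij R" by (metis inv bijI')
  define T' where "T' = (\<lambda>x. R (T (R' x)))"
  have T': "linear T'"
    using linear_compose[OF linear_compose[OF lin(2) T] lin(1)] by (simp add: T'_def o_def)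
  have axis: "R' (axis j 1) = axis (unorder j) 1" for j
    by (auto simp: R'_def axis_def vec_eq_iff wellorder_inverse unorder_inverse)
  have "matrix T' = (\<chi> i j. matrix T $ unorder i $ unorder j)"
    by (simp add: matrix_def T'_def axis vec_eq_iff) (simp add: R_def)
  then have "det (matrix T') = det (matrix T)"
    by (simp add: det_reindex[OF bij_unorder])
  moreover have "compact (R ` C)"
    using C(1) lin(1) by (intro compact_continuous_image linear_continuous_on)
      (auto simp: linear_conv_bounded_linear)
  moreover have "ifs T' (R u) (R ` C) \<subseteq> interior (R ` C)"
  proof -
    have "ifs T' (R u) (R ` C) = R ` ifs T u C"
      unfolding T'_def using lin(1) inv(1) by (rule ifs_linear_conjugate)
    also have "\<dots> \<subseteq> R ` interior C" using sub by (rule image_mono)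
    also have "\<dots> = interior (R ` C)"
      using interior_bijective_linear_image[OF lin(1) bij] by simp
    finally show ?thesis .
  qed
  ultimately have "(\<lambda>x. T' x + R u) ` R ` C \<inter> (\<lambda>x. T' x - R u) ` R ` C \<noteq> {}"
    using T' det C(2) by (intro ifs_images_intersect_wellorder) auto
  then obtain x y where "x \<in> C" "y \<in> C" "R (T x + u) = R (T y - u)"
    by (auto simp: T'_def inv linear_add[OF lin(1)] linear_diff[OF lin(1)])
  then show ?thesis using inv(1) by (metis (no_types, lifting) IntI empty_iff imageI)
qed

section \<open>Connectedness and digit expansion of the iterates\<close>

text \<open>The two images of a path connected set intersect, so their union is path connected. To
  repeat this, the induction carries compactness, non-emptiness and the inclusion into the interior
  along; convexity may be lost after one step.\<close>

lemma ifs_funpow_path_connected: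
  fixes T :: "real^'n \<Rightarrow> real^'n"
  assumes T: "linear T" and det: "\<bar>det (matrix T)\<bar> \<ge> 1 / 2"
    and C: "compact C" "path_connected C" "C \<noteq> {}" and sub: "ifs T u C \<subseteq> interior C"
  shows "path_connected ((ifs T u ^^ n) C)"
proof -
  have "inj T"
    using det det_nz_iff_inj[OF T] by auto
  \<comment> \<open>An injective \<open>T\<close> is an open map, so the next iterate inherits the
    inclusion into its own interior.\<close>
  then have interior: "ifs T u (interior S) \<subseteq> interior (ifs T u S)" for S
  proof -
    have "open (T ` interior S)"
      using T \<open>inj T\<close> linear_injective_imp_surjective
      by (intro open_surjective_linear_image) auto
    then have "open ((+) u ` T ` interior S \<union> (+) (- u) ` T ` interior S)"
      by (intro open_Un open_translation)
    also have "(+) u ` T ` interior S \<union> (+) (- u) ` T ` interior S = ifs T u (interior S)"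
      by (auto simp: ifs_def image_image add.commute)
    finally show ?thesis
      by (intro interior_maximal ifs_mono interior_subset)
  qed
  have cont: "continuous_on S T" for S
    using T by (simp add: linear_continuous_on linear_conv_bounded_linear)
  have "compact ((ifs T u ^^ n) C) \<and> path_connected ((ifs T u ^^ n) C) \<and> (ifs T u ^^ n) C \<noteq> {} \<and>
      ifs T u ((ifs T u ^^ n) C) \<subseteq> interior ((ifs T u ^^ n) C)"
  proof (induction n)
    case 0
    then show ?case using assms by simp
  next
    case (Suc n)
    define D where "D = (ifs T u ^^ n) C"
    have D: "compact D" "path_connected D" "D \<noteq> {}" "ifs T u D \<subseteq> interior D"
      using Suc by (auto simp: D_def)
    have "path_connected (ifs T u D)"
      unfolding ifs_def
      by (intro path_connected_Un path_connected_continuous_image D(2) continuous_intros cont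
          ifs_images_intersect[OF T det D(1,3,4)])
    moreover have "ifs T u (ifs T u D) \<subseteq> interior (ifs T u D)"
      using ifs_mono[OF D(4)] interior by blast
    moreover have "ifs T u D \<noteq> {}"
      using D(3) by (auto simp: ifs_def)
    ultimately show ?case
      using compact_ifs[OF T D(1)] by (simp flip: D_def)
  qed
  then show ?thesis by blast
qed

text \<open>Each application of the operator adds one digit, and the starting point survives only
  through \<open>(T ^^ n) b\<close>.\<close>

lemma ifs_funpow_expansion:
  assumes T: "linear T" and x: "x \<in> (ifs T u ^^ n) C"
  shows "\<exists>(a :: nat \<Rightarrow> real) b. (\<forall>k. a k \<in> {-1, 1}) \<and> b \<in> C \<and>
    x = (\<Sum>k<n. a k *\<^sub>R (T ^^ k) u) + (T ^^ n) b"
  using x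
proof (induction n arbitrary: x)
  case 0
  then show ?case by (intro exI[of _ "\<lambda>_. 1"] exI[of _ x]) simp
next
  case (Suc n)
  from Suc.prems obtain y c where y: "y \<in> (ifs T u ^^ n) C" and c: "c = -1 \<or> c = (1::real)" and x: "x = T y + c *\<^sub>R u"
  proof -
    have "\<exists>y\<in>(ifs T u ^^ n) C. x = T y + 1 *\<^sub>R u \<or> x = T y + (-1) *\<^sub>R u"
      using Suc.prems by (auto simp: ifs_def[of T u "(ifs T u ^^ n) C"])
    then show thesis using that by blast
  qed
  obtain a b where a: "\<forall>k. a k \<in> {-1, 1::real}" and b: "b \<in> C"
    and y_eq: "y = (\<Sum>k<n. a k *\<^sub>R (T ^^ k) u) + (T ^^ n) b"
    using Suc.IH[OF y] by blast
  \<comment> \<open>The map applied last contributes the digit with exponent 0;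
    \<open>case_nat\<close> puts it in front and shifts the others.\<close>
  have "case_nat c a k \<in> {-1, 1}" for k
    using a c by (cases k) auto
  moreover have "x = (\<Sum>k<Suc n. case_nat c a k *\<^sub>R (T ^^ k) u) + (T ^^ Suc n) b"
    by (simp add: x y_eq sum.lessThan_Suc_shift linear_add[OF T] linear_sum[OF T]
        linear_scale[OF T] del: sum.lessThan_Suc)
  ultimately show ?case using b by blast
qed

section \<open>Lattice translates of sums of paths\<close>

text \<open>Copies of \<open>g\<close> shifted by multiples of \<open>e\<close> join up at the
  integers, because \<open>g\<close> ends at its start plus \<open>e\<close>. They are pasted along
  finitely many closed unit intervals.\<close>

lemma path_periodic_extension:
  fixes g :: "real \<Rightarrow> 'a::real_normed_vector"
  assumes g: "path g" and fin: "pathfinish g = pathstart g + e"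
  shows "continuous_on {- of_int N .. of_int N} (\<lambda>t. g (frac t) + of_int \<lfloor>t\<rfloor> *\<^sub>R e)"
proof -
  define G where "G = (\<lambda>t::real. g (frac t) + of_int \<lfloor>t\<rfloor> *\<^sub>R e)"
  have "continuous_on {of_int m .. of_int m + 1} G" for m
  proof -
    have cont: "continuous_on {of_int m .. of_int m + 1} (\<lambda>t. g (t - of_int m) + of_int m *\<^sub>R e)"
      by (intro continuous_on_add continuous_on_const
          continuous_on_compose2[OF g[unfolded path_def]] continuous_on_diff continuous_on_id) auto
    show ?thesis
    proof (rule continuous_on_cong[THEN iffD1, OF refl _ cont])
      fix t :: real
      assume t: "t \<in> {of_int m .. of_int m + 1}"
      show "g (t - of_int m) + of_int m *\<^sub>R e = G t"
      \<comment> \<open>At the right endpoint the floor jumps to \<open>m + 1\<close> while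
        \<open>frac\<close> falls back to 0; the two jumps cancel by \<open>fin\<close>.\<close>
      proof (cases "t = of_int m + 1")
        case True
        then have "\<lfloor>t\<rfloor> = m + 1" "frac t = 0" by (auto simp: frac_def)
        then show ?thesis
          using True fin by (simp add: G_def pathfinish_def pathstart_def algebra_simps)
      next
        case False
        then have "\<lfloor>t\<rfloor> = m" using t by (intro floor_unique) auto
        then show ?thesis by (simp add: G_def frac_def)
      qed
    qed
  qed
  then have "continuous_on (\<Union>m\<in>{-N..N}. {of_int m .. of_int m + 1}) G"
    by (intro continuous_on_closed_Union) auto
  moreover have "{- of_int N .. of_int N} \<subseteq> (\<Union>m\<in>{-N..N}. {of_int m .. of_int m + 1 :: real})"
  proof
    fix t :: real
    assume t: "t \<in> {- of_int N .. of_int N}"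
    then have "\<lfloor>t\<rfloor> \<in> {-N..N}" by (auto simp: le_floor_iff floor_le_iff)
    moreover have "t \<in> {of_int \<lfloor>t\<rfloor> .. of_int \<lfloor>t\<rfloor> + 1}" using floor_correct[of t] by auto
    ultimately show "t \<in> (\<Union>m\<in>{-N..N}. {of_int m .. of_int m + 1 :: real})" by blast
  qed
  ultimately show ?thesis
    unfolding G_def by (rule continuous_on_subset)
qed

text \<open>The periodic extensions of the paths define a map at bounded distance from the linear
  isomorphism with matrix columns \<open>e i\<close>, so it is onto by Brouwer's fixed point theorem.\<close>

lemma lattice_translates_of_path_sums_cover:
  fixes e :: "'n::finite \<Rightarrow> real^'n"
  assumes inj: "inj (\<lambda>x::real^'n. \<Sum>i\<in>UNIV. x $ i *\<^sub>R e i)" and B: "0 \<le> B"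
  obtains N :: int where
    "\<And>g y. \<lbrakk>\<And>i. path (g i); \<And>i. path_image (g i) \<subseteq> cball 0 B;
        \<And>i. pathfinish (g i) = pathstart (g i) + e i; norm y \<le> 1\<rbrakk>
      \<Longrightarrow> \<exists>m p. (\<forall>i. m i \<in> {-N..N}) \<and> (\<forall>i. p i \<in> path_image (g i)) \<and>
            y = (\<Sum>i\<in>UNIV. p i) + (\<Sum>i\<in>UNIV. of_int (m i) *\<^sub>R e i)"
proof -
  define L where "L = (\<lambda>x::real^'n. \<Sum>i\<in>UNIV. x $ i *\<^sub>R e i)"
  have L: "linear L"
    by (auto simp: L_def linear_iff scaleR_add_left sum.distrib scaleR_sum_right)
  obtain L' where L': "linear L'" "\<And>x. L' (L x) = x" "\<And>x. L (L' x) = x"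
    using linear_injective_isomorphism[OF L] inj[folded L_def] by blast
  obtain c where c: "c > 0" "\<And>z. norm (L' z) \<le> norm z * c"
    using bounded_linear.pos_bounded[of L'] L'(1) by (auto simp: linear_conv_bounded_linear)
  \<comment> \<open>\<open>R\<close> bounds \<open>L' (y - (F x - L x))\<close> for all admissible
    paths and all \<open>y\<close> in the unit ball. It depends on \<open>e\<close> and
    \<open>B\<close> only, and so does its ceiling, the witness for \<open>N\<close>.\<close>
  define R where "R = (1 + (\<Sum>i\<in>UNIV. B + norm (e i))) * c"
  have "R > 0" using c B by (auto simp: R_def intro!: mult_pos_pos add_pos_nonneg sum_nonneg)
  show ?thesis
  proof
    fix g :: "'n \<Rightarrow> real \<Rightarrow> real^'n" and y :: "real^'n"
    assume path: "\<And>i. path (g i)" and im: "\<And>i. path_image (g i) \<subseteq> cball 0 B"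
      and fin: "\<And>i. pathfinish (g i) = pathstart (g i) + e i" and y: "norm y \<le> 1"
    define F where "F x = (\<Sum>i\<in>UNIV. g i (frac (x $ i)) + of_int \<lfloor>x $ i\<rfloor> *\<^sub>R e i)" for x :: "real^'n"
    have in_im: "g i (frac t) \<in> path_image (g i)" for i t
      by (auto simp: path_image_def intro!: imageI less_imp_le[OF frac_lt_1])
    have FL: "norm (F x - L x) \<le> (\<Sum>i\<in>UNIV. B + norm (e i))" for x
    proof -
      have "F x - L x = (\<Sum>i\<in>UNIV. g i (frac (x $ i)) - frac (x $ i) *\<^sub>R e i)"
        by (simp add: F_def L_def sum_subtractf[symmetric] frac_def algebra_simps)
      also have "norm \<dots> \<le> (\<Sum>i\<in>UNIV. B + norm (e i))"
      proof (rule sum_norm_le)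
        fix i
        have "norm (g i (frac (x $ i))) \<le> B"
          using in_im im[of i] by (auto simp: subset_iff)
        moreover have "norm (frac (x $ i) *\<^sub>R e i) \<le> norm (e i)"
          using frac_lt_1[of "x $ i"] by (simp add: mult_left_le_one_le)
        ultimately show "norm (g i (frac (x $ i)) - frac (x $ i) *\<^sub>R e i) \<le> B + norm (e i)"
          by (rule norm_triangle_le_diff[OF add_mono])
      qed
      finally show ?thesis .
    qed
    have le: "\<bar>x $ i\<bar> \<le> of_int \<lceil>R\<rceil>" if "x \<in> cball 0 R" for x :: "real^'n" and i
    proof -
      have "\<bar>x $ i\<bar> \<le> R" using that component_le_norm_cart[of x i] by simp
      then show ?thesis by linarith
    qed
    have "continuous_on (cball 0 R) F"
      unfolding F_def
    proof (intro continuous_on_sum)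
      fix i
      show "continuous_on (cball 0 R) (\<lambda>x. g i (frac (x $ i)) + of_int \<lfloor>x $ i\<rfloor> *\<^sub>R e i)"
        by (rule continuous_on_compose2[OF path_periodic_extension[OF path[of i] fin[of i], of "\<lceil>R\<rceil>"]])
           (use le in \<open>auto intro!: continuous_intros simp: abs_le_iff minus_le_iff\<close>)
    qed
    \<comment> \<open>A fixed point of this map satisfies \<open>L x = y - (F x - L x)\<close>, that
      is, \<open>F x = y\<close>.\<close>
    then have "continuous_on (cball 0 R) (\<lambda>x. L' (y - (F x - L x)))"
      using L L'(1) unfolding linear_conv_bounded_linear
      by (intro bounded_linear.continuous_on[of L'] continuous_intros bounded_linear.continuous_on[of L])
    moreover have "(\<lambda>x. L' (y - (F x - L x))) \<in> cball 0 R \<rightarrow> cball 0 R"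
    proof
      fix x
      have "norm (L' (y - (F x - L x))) \<le> norm (y - (F x - L x)) * c" by (rule c)
      also have "\<dots> \<le> R"
        unfolding R_def using c y FL[of x] by (intro mult_right_mono norm_triangle_le_diff) auto
      finally show "L' (y - (F x - L x)) \<in> cball 0 R" by simp
    qed
    ultimately obtain x where x: "x \<in> cball 0 R" "L' (y - (F x - L x)) = x"
      using brouwer_ball[OF \<open>R > 0\<close>] by blast
    then have "y - (F x - L x) = L x" using L'(3) by metis
    then have "y = F x" by simp
    moreover have "\<lfloor>x $ i\<rfloor> \<in> {- \<lceil>R\<rceil> .. \<lceil>R\<rceil>}" for i
      using le[OF x(1), of i] by (simp add: le_floor_iff floor_le_iff abs_le_iff; linarith)
    ultimately show "\<exists>m p. (\<forall>i. m i \<in> {- \<lceil>R\<rceil> .. \<lceil>R\<rceil>}) \<and> (\<forall>i. p i \<in> path_image (g i)) \<and>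
        y = (\<Sum>i\<in>UNIV. p i) + (\<Sum>i\<in>UNIV. of_int (m i) *\<^sub>R e i)"
      using in_im
      by (intro exI[of _ "\<lambda>i. \<lfloor>x $ i\<rfloor>"] exI[of _ "\<lambda>i. g i (frac (x $ i))"])
         (auto simp: F_def sum.distrib)
  qed
qed

text \<open>A finite union of closed sets with empty interior has empty interior. The union of the
  translates is closed, so approximating all points of the unit ball means containing it.\<close>

lemma interior_nonempty_if_translates_dense_in_ball:
  fixes A :: "'a::euclidean_space set"
  assumes "closed A" "finite P"
    and dense: "\<And>\<delta> y. \<delta> > 0 \<Longrightarrow> norm y \<le> 1 \<Longrightarrow> \<exists>v\<in>P. \<exists>a\<in>A. dist (v + a) y \<le> \<delta>"
  shows "interior A \<noteq> {}"
proof
  assume A: "interior A = {}"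
  define Z where "Z = (\<Union>v\<in>P. (+) v ` A)"
  have "closed ((+) v ` A)" for v
    using \<open>closed A\<close> by (rule closed_translation)
  then have closed: "closed (\<Union>v\<in>Q. (+) v ` A)" if "finite Q" for Q
    using that by auto
  have "interior (\<Union>v\<in>P. (+) v ` A) = {}"
    using \<open>finite P\<close>
  proof (induction P rule: finite_induct)
    case (insert v Q)
    have "interior ((+) v ` A) = {}"
      by (simp add: interior_translation A)
    then show ?case
      using insert closed interior_closed_Un_empty_interior[OF closed[OF insert(1)], of "(+) v ` A"]
      by (simp add: Un_commute)
  qed simp
  moreover have "cball 0 1 \<subseteq> Z"
  proof
    fix y :: 'a
    assume "y \<in> cball 0 1"
    then have y: "norm y \<le> 1" by simp
    have "y \<in> closure Z"
    proof (unfold closure_approachable, intro allI impI)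
      fix \<delta> :: real
      assume "\<delta> > 0"
      then obtain v a where "v \<in> P" "a \<in> A" "dist (v + a) y \<le> \<delta> / 2"
        using dense[of "\<delta> / 2" y] y by auto
      then show "\<exists>z\<in>Z. dist z y < \<delta>"
        using \<open>\<delta> > 0\<close> unfolding Z_def by (intro bexI[of _ "v + a"]) auto
    qed
    then show "y \<in> Z" using closed[OF \<open>finite P\<close>] by (simp add: Z_def)
  qed
  ultimately show False
    using interior_mono[of "cball 0 1" Z] by (auto simp: Z_def)
qed

section \<open>Series with digits plus and minus one\<close>

text \<open>By the M-test the series is a uniform limit of finite sums, hence a continuous function
  of the digits on the product \<open>D\<close>, which is compact by Tychonoff's theorem.\<close>

lemma compact_signed_series:
  fixes v :: "nat \<Rightarrow> 'a::banach"
  assumes "summable (\<lambda>k. norm (v k))"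
  shows "compact {(\<Sum>k. a k *\<^sub>R v k) | a :: nat \<Rightarrow> real. \<forall>k. a k \<in> {-1, 1}}"
proof -
  define D where "D = PiE UNIV (\<lambda>_::nat. {-1, 1::real})"
  have "compact D"
    unfolding compactin_euclidean_iff[symmetric] D_def euclidean_product_topology[symmetric]
      compactin_PiE by simp
  moreover have "continuous_on D (\<lambda>a. \<Sum>k. a k *\<^sub>R v k)"
  proof (rule uniform_limit_theorem)
    show "uniform_limit D (\<lambda>n a. \<Sum>k<n. a k *\<^sub>R v k) (\<lambda>a. \<Sum>k. a k *\<^sub>R v k) sequentially"
    proof (rule Weierstrass_m_test[OF _ assms])
      fix k a
      assume "a \<in> D"
      then have "a k \<in> {-1, 1}" by (auto simp: D_def PiE_iff)
      then show "norm (a k *\<^sub>R v k) \<le> norm (v k)" by auto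
    qed
    have "continuous_on D (\<lambda>a. a k)" for k
      by (rule continuous_on_subset[OF continuous_on_product_coordinates]) simp
    then show "\<forall>\<^sub>F n in sequentially. continuous_on D (\<lambda>a. \<Sum>k<n. a k *\<^sub>R v k)"
      by (intro always_eventually allI continuous_intros)
  qed simp
  ultimately have "compact ((\<lambda>a. \<Sum>k. a k *\<^sub>R v k) ` D)"
    by (intro compact_continuous_image)
  also have "(\<lambda>a. \<Sum>k. a k *\<^sub>R v k) ` D =
      {(\<Sum>k. a k *\<^sub>R v k) | a. \<forall>k. a k \<in> {-1, 1}}"
    by (auto simp: D_def PiE_iff)
  finally show ?thesis .
qed

text \<open>Convergence to 0 on the finitely many basis vectors is uniform on bounded sets.\<close>

lemma eventually_funpow_small:
  fixes f :: "'a::euclidean_space \<Rightarrow> 'a"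
  assumes f: "linear f" and sm: "\<And>x. summable (\<lambda>k. norm ((f ^^ k) x))" and "\<delta> > 0"
  shows "\<forall>\<^sub>F k in sequentially. \<forall>b. norm b \<le> B \<longrightarrow> norm ((f ^^ k) b) \<le> \<delta>"
proof -
  have "(\<lambda>k. \<Sum>b\<in>Basis. \<bar>B\<bar> * norm ((f ^^ k) b)) \<longlonglongrightarrow> (\<Sum>b\<in>(Basis :: 'a set). \<bar>B\<bar> * 0)"
  proof (rule tendsto_sum)
    fix b :: 'a
    show "(\<lambda>k. \<bar>B\<bar> * norm ((f ^^ k) b)) \<longlonglongrightarrow> \<bar>B\<bar> * 0"
      by (rule tendsto_mult_left[OF summable_LIMSEQ_zero[OF sm]])
  qed
  then have "\<forall>\<^sub>F k in sequentially. (\<Sum>b\<in>Basis. \<bar>B\<bar> * norm ((f ^^ k) b)) < \<delta>"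
    using \<open>\<delta> > 0\<close> by (auto intro: order_tendstoD)
  then show ?thesis
  proof (eventually_elim, intro allI impI)
    fix k and b :: 'a
    assume k: "(\<Sum>b\<in>Basis. \<bar>B\<bar> * norm ((f ^^ k) b)) < \<delta>" and b: "norm b \<le> B"
    note lin = linear_funpow[OF f, of k]
    have "(f ^^ k) b = (f ^^ k) (\<Sum>i\<in>Basis. (b \<bullet> i) *\<^sub>R i)" by (simp add: euclidean_representation)
    also have "\<dots> = (\<Sum>i\<in>Basis. (b \<bullet> i) *\<^sub>R (f ^^ k) i)"
      by (simp add: linear_sum[OF lin] linear_scale[OF lin])
    also have "norm \<dots> \<le> (\<Sum>i\<in>Basis. \<bar>B\<bar> * norm ((f ^^ k) i))"
      using b by (intro sum_norm_le) (auto intro!: mult_right_mono order_trans[OF Basis_le_norm])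
    finally show "norm ((f ^^ k) b) \<le> \<delta>" using k by simp
  qed
qed

text \<open>The exponents \<open>j + k * d\<close> with \<open>j < d\<close> run through the
  naturals once, so the digits of the points \<open>x j\<close> interleave to a single sequence. Two
  errors remain, the images of points of \<open>C\<close> and the tail of the series, each at most
  \<open>\<delta> / 2\<close>.\<close>

lemma ifs_funpow_near_signed_series:
  fixes f :: "'a::euclidean_space \<Rightarrow> 'a"
  assumes f: "linear f" and sm: "\<And>x. summable (\<lambda>k. norm ((f ^^ k) x))"
    and "d > 0" and C: "bounded C" and \<delta>: "\<delta> > 0"
  shows "\<forall>\<^sub>F n in sequentially. \<forall>x. (\<forall>j<d. x j \<in> (ifs (f ^^ d) u ^^ n) C) \<longrightarrow>
    (\<exists>a :: nat \<Rightarrow> real. (\<forall>k. a k \<in> {-1, 1}) \<and>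
        norm ((\<Sum>j<d. (f ^^ j) (x j)) - (\<Sum>k. a k *\<^sub>R (f ^^ k) u)) \<le> \<delta>)"
proof -
  obtain B where B: "\<And>b. b \<in> C \<Longrightarrow> norm b \<le> B" using C by (auto simp: bounded_iff)
  have d_top: "filterlim (\<lambda>n. n * d) sequentially sequentially"
    using \<open>d > 0\<close> by (simp add: mult_nat_right_at_top)
  \<comment> \<open>There are \<open>d\<close> remainders, one for each \<open>j\<close>, which
    together may use up \<open>\<delta> / 2\<close>.\<close>
  obtain K where K: "\<And>k b. k \<ge> K \<Longrightarrow> norm b \<le> B \<Longrightarrow> norm ((f ^^ k) b) \<le> \<delta> / 2 / d"
    using eventually_funpow_small[OF f sm, of "\<delta> / 2 / d" B] \<delta> \<open>d > 0\<close>
    by (auto simp: eventually_sequentially)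
  have "(\<lambda>n. \<Sum>k. norm ((f ^^ (k + n)) u)) \<longlonglongrightarrow> 0"
    using suminf_exist_split2[OF sm] by simp
  then have "\<forall>\<^sub>F n in sequentially. (\<Sum>k. norm ((f ^^ (k + n)) u)) < \<delta> / 2"
    using \<delta> by (intro order_tendstoD) auto
  then have "\<forall>\<^sub>F n in sequentially. n \<ge> K \<and> (\<Sum>k. norm ((f ^^ (k + n)) u)) < \<delta> / 2"
    using eventually_ge_at_top[of K] by (rule eventually_conj[rotated])
  then have "\<forall>\<^sub>F n in sequentially. n * d \<ge> K \<and> (\<Sum>k. norm ((f ^^ (k + n * d)) u)) < \<delta> / 2"
    by (rule eventually_compose_filterlim[OF _ d_top])
  then show ?thesis
  proof (eventually_elim, intro allI impI)
    fix n x
    assume n: "K \<le> n * d \<and> (\<Sum>k. norm ((f ^^ (k + n * d)) u)) < \<delta> / 2"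
      and x: "\<forall>j<d. x j \<in> (ifs (f ^^ d) u ^^ n) C"
    note lin = linear_funpow[OF f]
    have "\<exists>a b. (\<forall>k. a k \<in> {-1, 1::real}) \<and> b \<in> C \<and>
        x j = (\<Sum>k<n. a k *\<^sub>R (f ^^ (k * d)) u) + (f ^^ (n * d)) b" if "j < d" for j
      using ifs_funpow_expansion[OF lin x[rule_format, OF that]]
      by (simp only: funpow_mult mult.commute[of d])
    then have "\<forall>j. \<exists>a b. j < d \<longrightarrow> (\<forall>k. a k \<in> {-1, 1::real}) \<and> b \<in> C \<and>
        x j = (\<Sum>k<n. a k *\<^sub>R (f ^^ (k * d)) u) + (f ^^ (n * d)) b"
      by blast
    from choice[OF this] obtain a where "\<forall>j. \<exists>b. j < d \<longrightarrow> (\<forall>k. a j k \<in> {-1, 1::real}) \<and> b \<in> C \<and>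
        x j = (\<Sum>k<n. a j k *\<^sub>R (f ^^ (k * d)) u) + (f ^^ (n * d)) b" ..
    from choice[OF this] obtain b where ab: "\<forall>j. j < d \<longrightarrow> (\<forall>k. a j k \<in> {-1, 1::real}) \<and> b j \<in> C \<and>
        x j = (\<Sum>k<n. a j k *\<^sub>R (f ^^ (k * d)) u) + (f ^^ (n * d)) (b j)" ..
    then have a: "a j k \<in> {-1, 1::real}" and b: "b j \<in> C"
      and x_eq: "x j = (\<Sum>k<n. a j k *\<^sub>R (f ^^ (k * d)) u) + (f ^^ (n * d)) (b j)" if "j < d" for j k
      using that by blast+
    \<comment> \<open>From \<open>n * d\<close> on, these are whatever digits \<open>a\<close>
      supplies; only their absolute value matters there.\<close>
    define c where "c i = a (i mod d) (i div d)" for i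
    have c: "c i \<in> {-1, 1}" for i
      using a[of "i mod d" "i div d"] \<open>d > 0\<close> by (simp add: c_def)
    have abs_c: "\<bar>c i\<bar> = 1" for i using c[of i] by auto
    have sm_c: "summable (\<lambda>k. norm (c k *\<^sub>R (f ^^ k) u))"
      by (simp add: abs_c sm)
    have sm_tail: "summable (\<lambda>k. norm (c (k + n * d) *\<^sub>R (f ^^ (k + n * d)) u))"
      using sm_c by (rule summable_ignore_initial_segment)
    \<comment> \<open>To be used with \<open>s\<close> the sum of the points, \<open>p\<close> the
      initial segment and \<open>t\<close> the tail of the series, and \<open>q\<close> the sum of
      the remainders.\<close>
    have cancel: "s - (t + p) = q - t" if "s = p + q" for s t p q :: 'a
      using that by simp
    have "(\<Sum>j<d. (f ^^ j) (x j)) =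
        (\<Sum>j<d. \<Sum>k<n. a j k *\<^sub>R (f ^^ (j + k * d)) u) + (\<Sum>j<d. (f ^^ (j + n * d)) (b j))"
      by (simp add: x_eq linear_add[OF lin] linear_sum[OF lin] linear_scale[OF lin] funpow_add sum.distrib)
    also have "(\<Sum>j<d. \<Sum>k<n. a j k *\<^sub>R (f ^^ (j + k * d)) u) = (\<Sum>i<n * d. c i *\<^sub>R (f ^^ i) u)"
    proof -
      have "(\<Sum>j<d. \<Sum>k<n. a j k *\<^sub>R (f ^^ (j + k * d)) u) = (\<Sum>k<n. \<Sum>j<d. c (j + k * d) *\<^sub>R (f ^^ (j + k * d)) u)"
        by (subst sum.swap) (auto simp: c_def intro!: sum.cong)
      also have "\<dots> = (\<Sum>k<n. \<Sum>i\<in>{k * d..<k * d + d}. c i *\<^sub>R (f ^^ i) u)"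
      proof (rule sum.cong[OF refl])
        fix k
        show "(\<Sum>j<d. c (j + k * d) *\<^sub>R (f ^^ (j + k * d)) u) = (\<Sum>i\<in>{k * d..<k * d + d}. c i *\<^sub>R (f ^^ i) u)"
          by (rule sum.reindex_bij_witness[of _ "\<lambda>i. i - k * d" "\<lambda>j. j + k * d"]) auto
      qed
      finally show ?thesis unfolding sum.nat_group .
    qed
    finally have "(\<Sum>j<d. (f ^^ j) (x j)) - (\<Sum>k. c k *\<^sub>R (f ^^ k) u) =
        (\<Sum>j<d. (f ^^ (j + n * d)) (b j)) - (\<Sum>k. c (k + n * d) *\<^sub>R (f ^^ (k + n * d)) u)"
      unfolding suminf_split_initial_segment[OF summable_norm_cancel[OF sm_c], of "n * d"]
      by (rule cancel)
    also have "norm \<dots> \<le> (\<Sum>j<d. \<delta> / 2 / d) + (\<Sum>k. norm ((f ^^ (k + n * d)) u))"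
    proof (rule norm_triangle_le_diff[OF add_mono])
      show "norm (\<Sum>j<d. (f ^^ (j + n * d)) (b j)) \<le> (\<Sum>j<d. \<delta> / 2 / d)"
      proof (rule sum_norm_le)
        fix j
        assume "j \<in> {..<d}"
        then have "norm (b j) \<le> B" using B b by simp
        then show "norm ((f ^^ (j + n * d)) (b j)) \<le> \<delta> / 2 / d"
          by (rule K[rotated]) (use n in simp)
      qed
      show "norm (\<Sum>k. c (k + n * d) *\<^sub>R (f ^^ (k + n * d)) u) \<le> (\<Sum>k. norm ((f ^^ (k + n * d)) u))"
        using summable_norm[OF sm_tail] by (simp add: abs_c)
    qed
    also have "\<dots> \<le> \<delta>" using n \<open>d > 0\<close> by simp
    finally show "\<exists>a :: nat \<Rightarrow> real. (\<forall>k. a k \<in> {-1, 1}) \<and>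
        norm ((\<Sum>j<d. (f ^^ j) (x j)) - (\<Sum>k. a k *\<^sub>R (f ^^ k) u)) \<le> \<delta>"
      using c by blast
  qed
qed

section \<open>Cyclic vectors and eigenvalues\<close>

text \<open>The combinations indexed by \<open>K\<close> form a subspace containing every
  \<open>v k\<close>. Indexing by \<open>K\<close> rather than by vectors covers families with
  repetitions.\<close>

lemma in_span_image_sum:
  fixes v :: "'b \<Rightarrow> 'a::real_vector"
  assumes "finite K" "x \<in> span (v ` K)"
  shows "\<exists>c. x = (\<Sum>k\<in>K. c k *\<^sub>R v k)"
proof -
  define W where "W = range (\<lambda>c. \<Sum>k\<in>K. c k *\<^sub>R v k)"
  have W: "(\<Sum>k\<in>K. c k *\<^sub>R v k) \<in> W" for c by (simp add: W_def)
  have "subspace W"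
  proof (rule subspaceI)
    show "0 \<in> W" using W[of "\<lambda>_. 0"] by simp
    fix x y
    assume "x \<in> W" "y \<in> W"
    then obtain c c' where "x = (\<Sum>k\<in>K. c k *\<^sub>R v k)" "y = (\<Sum>k\<in>K. c' k *\<^sub>R v k)"
      by (auto simp: W_def)
    then show "x + y \<in> W"
      using W[of "\<lambda>k. c k + c' k"] by (simp add: scaleR_add_left sum.distrib)
  next
    fix r x
    assume "x \<in> W"
    then obtain c where "x = (\<Sum>k\<in>K. c k *\<^sub>R v k)" by (auto simp: W_def)
    then show "r *\<^sub>R x \<in> W"
      using W[of "\<lambda>k. r * c k"] by (simp add: scaleR_sum_right)
  qed
  moreover have "v j \<in> W" if "j \<in> K" for j
    using W[of "\<lambda>k. if k = j then 1 else 0"] that assms(1) by (simp add: if_distrib[of "\<lambda>c. c *\<^sub>R _"] cong: if_cong)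
  ultimately have "span (v ` K) \<subseteq> W"
    by (intro span_minimal) auto
  then show ?thesis using assms(2) by (auto simp: W_def)
qed

text \<open>If an iterate with index \<open>k\<close> below the dimension depended on the earlier
  ones, their span would be invariant under \<open>f\<close> and contain the whole orbit, making the
  dimension at most \<open>k\<close>.\<close>

lemma krylov_basis:
  fixes f :: "'a::euclidean_space \<Rightarrow> 'a"
  assumes f: "linear f" and cyc: "span (range (\<lambda>k. (f ^^ k) u)) = UNIV"
  shows "span ((\<lambda>k. (f ^^ k) u) ` {..<DIM('a)}) = UNIV"
    and "\<And>r k. (\<Sum>k<DIM('a). r k *\<^sub>R (f ^^ k) u) = 0 \<Longrightarrow> k < DIM('a) \<Longrightarrow> r k = 0"
proof -
  define v where "v k = (f ^^ k) u" for k
  have notin: "v k \<notin> span (v ` {..<k})" if "k < DIM('a)" for k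
  proof
    assume k: "v k \<in> span (v ` {..<k})"
    have v_in: "v j \<in> span (v ` {..<k})" if "j \<le> k" for j
      using that k by (cases "j = k") (auto intro: span_base)
    have "f ` span (v ` {..<k}) \<subseteq> span (v ` {..<k})"
    proof -
      have "f ` span (v ` {..<k}) = span (f ` v ` {..<k})"
        by (rule linear_span_image[OF f, symmetric])
      also have "\<dots> \<subseteq> span (v ` {..<k})"
      proof (intro span_minimal subsetI subspace_span)
        fix x
        assume "x \<in> f ` v ` {..<k}"
        then obtain j where "j < k" "x = v (Suc j)" by (auto simp: v_def)
        then show "x \<in> span (v ` {..<k})" using v_in by simp
      qed
      finally show ?thesis .
    qed
    then have "v n \<in> span (v ` {..<k})" for n
    proof (induction n)
      case 0
      show ?case using v_in[of 0] by simp
    next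
      case (Suc n)
      then have "f (v n) \<in> span (v ` {..<k})" by blast
      then show ?case by (simp add: v_def)
    qed
    then have "span (range v) \<subseteq> span (v ` {..<k})"
      by (intro span_minimal) auto
    then have "(UNIV :: 'a set) \<subseteq> span (v ` {..<k})"
      using cyc by (simp add: v_def)
    then have "dim (UNIV :: 'a set) \<le> card (v ` {..<k})"
      by (intro dim_le_card) auto
    also have "\<dots> \<le> k" using card_image_le[of "{..<k}" v] by simp
    finally show False using that by simp
  qed
  have "independent (v ` {..<k}) \<and> inj_on v {..<k}" if "k \<le> DIM('a)" for k
    using that
  proof (induction k)
    case (Suc k)
    then have "v k \<notin> span (v ` {..<k})" using notin by simp
    moreover from this have "v k \<notin> v ` {..<k}" using span_base[of "v k"] by metis
    ultimately show ?case
      using Suc by (auto simp: lessThan_Suc independent_insert)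
  qed (simp add: independent_empty)
  then have ind: "independent (v ` {..<DIM('a)})" and inj: "inj_on v {..<DIM('a)}" by auto
  then have "dim (v ` {..<DIM('a)}) = DIM('a)"
    by (simp add: dim_eq_card_independent card_image)
  then show "span ((\<lambda>k. (f ^^ k) u) ` {..<DIM('a)}) = UNIV"
    unfolding v_def by (simp add: dim_eq_full)
  fix r k
  assume r: "(\<Sum>k<DIM('a). r k *\<^sub>R (f ^^ k) u) = 0" and k: "k < DIM('a)"
  have "(\<Sum>x\<in>v ` {..<DIM('a)}. r (inv_into {..<DIM('a)} v x) *\<^sub>R x) = (\<Sum>k<DIM('a). r k *\<^sub>R v k)"
    using inj by (simp add: sum.reindex)
  also have "\<dots> = 0" using r by (simp add: v_def)
  finally have "r (inv_into {..<DIM('a)} v (v k)) = 0"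
    using independentD[OF ind, of "v ` {..<DIM('a)}" "\<lambda>x. r (inv_into {..<DIM('a)} v x)" "v k"] k by blast
  then show "r k = 0" using inj k by simp
qed

text \<open>In the basis of iterates of \<open>u\<close> the map \<open>f\<close> has a companion matrix.\<close>

lemma abs_det_companion:
  fixes f :: "real^'n \<Rightarrow> real^'n" and h :: "'n \<Rightarrow> nat" and c :: "nat \<Rightarrow> real"
  assumes f: "linear f" and h: "bij_betw h UNIV {..<CARD('n)}"
    and cyc: "span (range (\<lambda>k. (f ^^ k) u)) = UNIV"
    and c: "(f ^^ CARD('n)) u = (\<Sum>k<CARD('n). c k *\<^sub>R (f ^^ k) u)"
  shows "\<bar>det (matrix f)\<bar> = \<bar>c 0\<bar>"
proof -
  define d where "d = CARD('n)"
  have "d > 0" by (simp add: d_def)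
  define v where "v k = (f ^^ k) u" for k
  define h' where "h' = inv_into UNIV h"
  have h': "h (h' k) = k" if "k < d" for k
    using h that by (auto simp: h'_def bij_betw_def d_def f_inv_into_f)
  have hh': "h' (h i) = i" for i
    using h by (auto simp: h'_def bij_betw_def)
  have h_less: "h i < d" for i
    using h by (auto simp: bij_betw_def d_def)
  \<comment> \<open>The rows of \<open>A\<close> are the iterates below \<open>d\<close>, those of
    \<open>B\<close> their images under \<open>f\<close>. As vectors are written as rows,
    \<open>f\<close> acts from the right by its transpose.\<close>
  define A :: "real^'n^'n" where "A = (\<chi> i. v (h i))"
  define B :: "real^'n^'n" where "B = (\<chi> i. v (Suc (h i)))"
  have "B = A ** transpose (matrix f)"
  proof -
    have "v (Suc k) $ j = (\<Sum>l\<in>UNIV. v k $ l * matrix f $ j $ l)" for j k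
    proof -
      have "v (Suc k) = matrix f *v v k" using f by (simp add: v_def matrix_works)
      then show ?thesis by (simp add: matrix_vector_mult_def mult.commute)
    qed
    then show ?thesis
      by (simp add: A_def B_def vec_eq_iff matrix_matrix_mult_def transpose_def)
  qed
  then have det_B: "det B = det A * det (matrix f)" by (simp add: det_mul)
  have "det A \<noteq> 0"
  proof -
    have "inj ((*v) (transpose A))"
    proof (rule injI)
      fix x y
      assume "transpose A *v x = transpose A *v y"
      then have "transpose A *v (x - y) = 0" by (simp add: matrix_vector_mult_diff_distrib)
      then have "(\<Sum>i\<in>UNIV. (x - y) $ i *\<^sub>R v (h i)) = 0"
        by (simp add: vec_eq_iff matrix_vector_mult_def transpose_def A_def mult.commute)
      also have "(\<Sum>i\<in>UNIV. (x - y) $ i *\<^sub>R v (h i)) = (\<Sum>k<d. (x - y) $ h' k *\<^sub>R v k)"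
        using sum.reindex_bij_betw[OF h, of "\<lambda>k. (x - y) $ h' k *\<^sub>R v k"] by (simp only: hh' d_def)
      finally have "(x - y) $ h' k = 0" if "k < d" for k
        using krylov_basis(2)[OF f cyc, of "\<lambda>k. (x - y) $ h' k" k] that
        by (simp add: d_def v_def)
      from this[OF h_less] show "x = y" by (simp add: vec_eq_iff hh')
    qed
    then have "det (transpose A) \<noteq> 0"
      using det_nz_iff_inj[of "(*v) (transpose A)"] by simp
    then show ?thesis by simp
  qed
  define i0 where "i0 = h' (d - 1)"
  have i0: "h i0 = d - 1" using h'[of "d - 1"] \<open>d > 0\<close> by (simp add: i0_def)
  \<comment> \<open>A cyclic shift: row \<open>i\<close> of \<open>B\<close> is row
    \<open>p i\<close> of \<open>A\<close>, except for \<open>i = i0\<close>, where \<open>p\<close>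
    wraps around to position 0.\<close>
  define p where "p i = h' (Suc (h i) mod d)" for i
  have h_p: "h (p i) = Suc (h i) mod d" for i
    using h' \<open>d > 0\<close> by (simp add: p_def)
  have p_if: "h (p i) = (if i = i0 then 0 else Suc (h i))" for i
  proof (cases "i = i0")
    case True
    then show ?thesis using \<open>d > 0\<close> by (simp add: h_p i0)
  next
    case False
    then have "h i \<noteq> d - 1" by (metis hh' i0_def)
    then have "Suc (h i) < d" using h_less[of i] by linarith
    then show ?thesis using False by (simp add: h_p)
  qed
  have "inj p"
  proof (rule injI)
    fix i j
    assume "p i = p j"
    then have "h (p i) = h (p j)" by simp
    then have "h i = h j" unfolding p_if by (auto split: if_splits)
    then show "i = j" by (metis hh')
  qed
  then have p: "p permutes UNIV"
    by (intro bij_imp_permutes) (auto simp: bij_def finite_UNIV_inj_surj)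
  \<comment> \<open>Adding \<open>w\<close> to row \<open>i0\<close> of \<open>B\<close>, which is
    \<open>v d\<close>, leaves only \<open>c 0 *s v 0\<close>. The iterates in \<open>w\<close> are
    other rows of \<open>B\<close>, so the determinant does not change.\<close>
  define w where "w = - (\<Sum>k\<in>{1..<d}. c k *\<^sub>R v k)"
  have "w \<in> vec.span {row j B | j. j \<noteq> i0}"
  proof -
    have "v k \<in> {row j B | j. j \<noteq> i0}" if "k \<in> {1..<d}" for k
    proof -
      have k: "h (h' (k - 1)) = k - 1" using that by (intro h') auto
      then have "row (h' (k - 1)) B = v k" "h' (k - 1) \<noteq> i0"
        using that i0 by (auto simp: row_def B_def vec_eq_iff)
      then show ?thesis by (intro CollectI exI[of _ "h' (k - 1)"]) simp
    qed
    then show ?thesis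
      unfolding w_def scalar_mult_eq_scaleR[symmetric]
      by (intro vec.span_neg vec.span_sum vec.span_scale vec.span_base)
  qed
  then have "det B = det (\<chi> k. if k = i0 then row i0 B + w else row k B)"
    by (rule det_row_span[symmetric])
  also have "row i0 B + w = c 0 *s v 0"
  proof -
    have "row i0 B = v d" using i0 \<open>d > 0\<close> by (simp add: row_def B_def vec_eq_iff)
    also have "\<dots> = (\<Sum>k<d. c k *\<^sub>R v k)" using c by (simp add: v_def d_def)
    also have "\<dots> = c 0 *\<^sub>R v 0 + (\<Sum>k\<in>{1..<d}. c k *\<^sub>R v k)"
      using \<open>d > 0\<close> by (simp add: lessThan_atLeast0 sum.atLeast_Suc_lessThan)
    finally show ?thesis by (simp add: w_def scalar_mult_eq_scaleR)
  qed
  also have "det (\<chi> k. if k = i0 then c 0 *s v 0 else row k B) =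
      c 0 * det (\<chi> k. if k = i0 then v 0 else row k B)"
    by (rule det_row_mul)
  also have "(\<chi> k. if k = i0 then v 0 else row k B) = (\<chi> i. A $ p i)"
    by (simp add: A_def p_if vec_eq_iff row_def B_def)
  also have "det (\<chi> i. A $ p i) = of_int (sign p) * det A"
    using p by (rule det_permute_rows)
  finally have "det (matrix f) = c 0 * of_int (sign p)"
    unfolding det_B using \<open>det A \<noteq> 0\<close> by simp
  then show ?thesis by (simp add: abs_mult sign_def)
qed

section \<open>Complex polynomials in the matrix and summability of orbits\<close>

definition cvec :: "real^'n \<Rightarrow> complex^'n" where
  "cvec x = (\<chi> i. complex_of_real (x $ i))"

abbreviation cmat :: "real^'n^'n \<Rightarrow> complex^'n^'n" where
  "cmat M \<equiv> map_matrix complex_of_real M"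

lemma matrix_vector_mult_sum_distrib:
  fixes A :: "'a::field^'n^'m"
  shows "A *v sum g S = (\<Sum>i\<in>S. A *v g i)"
  by (rule vec.linear_sum[OF matrix_vector_mul_linear_gen])

lemma cmat_mult_cvec: "cmat M *v cvec x = cvec (M *v x)"
  by (simp add: cvec_def vec_eq_iff matrix_vector_mult_def map_matrix_def)

lemma norm_cvec: "norm (cvec x) = norm x"
  by (simp add: norm_vec_def cvec_def)

lemma norm_smult_vec: "norm (c *s x) = cmod c * norm (x :: complex^'n)"
  by (simp add: norm_vec_def norm_mult L2_set_right_distrib)

lemma funpow_cmat_cvec: "((*v) (cmat M) ^^ k) (cvec x) = cvec (((*v) M ^^ k) x)"
  by (induction k) (simp_all add: cmat_mult_cvec)

text \<open>The vector \<open>p(M) u\<close> for a complex polynomial \<open>p\<close>.\<close>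

definition poly_orbit :: "real^'n^'n \<Rightarrow> real^'n \<Rightarrow> complex poly \<Rightarrow> complex^'n" where
  "poly_orbit M u p = (\<Sum>k\<le>degree p. coeff p k *s cvec (((*v) M ^^ k) u))"

lemma poly_orbit_extend:
  assumes "degree p \<le> N"
  shows "poly_orbit M u p = (\<Sum>k\<le>N. coeff p k *s cvec (((*v) M ^^ k) u))"
  unfolding poly_orbit_def using assms
  by (intro sum.mono_neutral_left) (auto simp: coeff_eq_0)

text \<open>The factor \<open>[:-z, 1:]\<close> acts on vectors as \<open>M - z\<close>. Thus a root
  of an annihilating polynomial can yield an eigenvector, and linear factors can be removed one at a
  time.\<close>

lemma poly_orbit_linear_factor:
  "poly_orbit M u ([:-z, 1:] * p) = cmat M *v poly_orbit M u p - z *s poly_orbit M u p"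
proof -
  define w where "w k = cvec (((*v) M ^^ k) u)" for k
  have "degree ([:-z, 1:] * p) \<le> Suc (degree p)"
    using degree_mult_le[of "[:-z, 1:]" p] by simp
  then have "poly_orbit M u ([:-z, 1:] * p) = (\<Sum>k\<le>Suc (degree p). coeff ([:-z, 1:] * p) k *s w k)"
    unfolding w_def by (rule poly_orbit_extend)
  \<comment> \<open>\<open>pCons 0 p\<close> is \<open>p\<close> times the indeterminate, which
    moves each coefficient to the next iterate.\<close>
  also have "\<dots> = (\<Sum>k\<le>Suc (degree p). coeff (pCons 0 p) k *s w k) - z *s (\<Sum>k\<le>Suc (degree p). coeff p k *s w k)"
  proof -
    have "coeff ([:-z, 1:] * p) k *s w k = coeff (pCons 0 p) k *s w k - z *s (coeff p k *s w k)" for k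
      by (simp add: vector_smult_assoc flip: vector_sub_rdistrib)
    then show ?thesis by (simp only: sum_subtractf vec.scale_sum_right)
  qed
  also have "(\<Sum>k\<le>Suc (degree p). coeff p k *s w k) = poly_orbit M u p"
    unfolding w_def by (rule poly_orbit_extend[symmetric]) simp
  also have "(\<Sum>k\<le>Suc (degree p). coeff (pCons 0 p) k *s w k) = (\<Sum>k\<le>degree p. coeff p k *s w (Suc k))"
    by (simp add: sum.atMost_Suc_shift del: sum.atMost_Suc)
  also have "\<dots> = cmat M *v poly_orbit M u p"
    by (simp add: poly_orbit_def w_def matrix_vector_mult_sum_distrib
        cmat_mult_cvec[symmetric] vector_scalar_commute)
  finally show ?thesis .
qed


text \<open>Summing the recurrence bounds each partial sum by \<open>q\<close> times itself plus a
  constant; as \<open>q < 1\<close>, solving for it gives a uniform bound.\<close>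

lemma summable_linear_recurrence_bound:
  fixes a b :: "nat \<Rightarrow> real"
  assumes rec: "\<And>k. a (Suc k) \<le> q * a k + b k" and "\<And>k. 0 \<le> a k" "\<And>k. 0 \<le> b k"
    and q: "0 \<le> q" "q < 1" and b: "summable b"
  shows "summable a"
proof (rule summableI_nonneg_bounded)
  fix n
  have "(\<Sum>k<Suc n. a k) = a 0 + (\<Sum>k<n. a (Suc k))"
    by (rule sum.lessThan_Suc_shift)
  also have "(\<Sum>k<n. a (Suc k)) \<le> (\<Sum>k<n. q * a k + b k)"
    by (intro sum_mono rec)
  also have "\<dots> = q * (\<Sum>k<n. a k) + (\<Sum>k<n. b k)"
    by (simp add: sum.distrib sum_distrib_left)
  also have "(\<Sum>k<n. b k) \<le> suminf b"
    using assms by (intro sum_le_suminf) auto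
  finally have "(\<Sum>k<n. a k) \<le> a 0 + (q * (\<Sum>k<n. a k) + suminf b)"
    using assms(2)[of n] by simp
  then show "(\<Sum>k<n. a k) \<le> (a 0 + suminf b) / (1 - q)"
    using q by (simp add: field_simps)
qed (use assms in auto)

text \<open>The next iterate of \<open>x\<close> is \<open>z\<close> times the current one plus the
  iterate of \<open>A *v x - z *s x\<close>, so the norms obey a linear recurrence with factor
  \<open>cmod z\<close>.\<close>

lemma summable_cmat_funpow_step:
  fixes x :: "complex^'n"
  assumes z: "cmod z < 1"
    and sm: "summable (\<lambda>k. norm (((*v) A ^^ k) (A *v x - z *s x)))"
  shows "summable (\<lambda>k. norm (((*v) A ^^ k) x))"
proof (rule summable_linear_recurrence_bound[OF _ _ _ _ z sm])
  fix k
  have "((*v) A ^^ Suc k) x = z *s ((*v) A ^^ k) x + ((*v) A ^^ k) (A *v x - z *s x)"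
  proof (induction k)
    case (Suc k)
    have "((*v) A ^^ Suc (Suc k)) x = A *v (((*v) A ^^ Suc k) x)" by simp
    also have "\<dots> = A *v (z *s ((*v) A ^^ k) x + ((*v) A ^^ k) (A *v x - z *s x))"
      by (simp only: Suc)
    also have "\<dots> = z *s ((*v) A ^^ Suc k) x + ((*v) A ^^ Suc k) (A *v x - z *s x)"
      by (simp add: matrix_vector_right_distrib vector_scalar_commute)
    finally show ?case .
  qed simp
  then show "norm (((*v) A ^^ Suc k) x) \<le> cmod z * norm (((*v) A ^^ k) x)
      + norm (((*v) A ^^ k) (A *v x - z *s x))"
    by (metis norm_smult_vec norm_triangle_ineq)
qed auto

text \<open>Peeling off the linear factors one at a time needs neither a Jordan form nor an adapted norm.\<close>

lemma summable_poly_orbit: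
  assumes "\<And>z. z \<in># Z \<Longrightarrow> cmod z < 1"
    and "summable (\<lambda>k. norm (((*v) (cmat M) ^^ k) (poly_orbit M u ((\<Prod>z\<in>#Z. [:-z, 1:]) * q))))"
  shows "summable (\<lambda>k. norm (((*v) (cmat M) ^^ k) (poly_orbit M u q)))"
  using assms
proof (induction Z)
  case (add z Z)
  have eq: "poly_orbit M u ((\<Prod>z\<in>#add_mset z Z. [:-z, 1:]) * q) =
      cmat M *v poly_orbit M u ((\<Prod>z\<in>#Z. [:-z, 1:]) * q) - z *s poly_orbit M u ((\<Prod>z\<in>#Z. [:-z, 1:]) * q)"
    using poly_orbit_linear_factor[of M u z "(\<Prod>z\<in>#Z. [:-z, 1:]) * q"]
    by (simp only: prod_mset.add_mset image_mset_add_mset mult.assoc)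
  have "cmod z < 1" using add.prems(1) by simp
  then have "summable (\<lambda>k. norm (((*v) (cmat M) ^^ k) (poly_orbit M u ((\<Prod>z\<in>#Z. [:-z, 1:]) * q))))"
    by (rule summable_cmat_funpow_step) (rule add.prems(2)[unfolded eq])
  then show ?case using add.IH add.prems(1) by simp
qed simp

lemma cyclic_funpow:
  fixes M :: "real^'n^'n"
  assumes "cyclic M u"
  shows "span (range (\<lambda>k. ((*v) M ^^ k) u)) = UNIV"
  using assms by (simp add: cyclic_def orbit_def[abs_def] image_def)

text \<open>The real and imaginary parts of the coefficients give two real linear relations among
  the first \<open>CARD('n)\<close> iterates, which are independent.\<close>

lemma poly_orbit_eq_0:
  fixes M :: "real^'n^'n"
  assumes "cyclic M u" "degree q < CARD('n)" "poly_orbit M u q = 0"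
  shows "q = 0"
proof -
  have "(\<Sum>k<CARD('n). coeff q k *s cvec (((*v) M ^^ k) u)) = 0"
    using assms(3) poly_orbit_extend[of q "CARD('n) - 1" M u] assms(2)
    by (simp add: lessThan_Suc_atMost[symmetric] del: lessThan_Suc)
  then have *: "(\<Sum>k<CARD('n). coeff q k * of_real ((((*v) M ^^ k) u) $ i)) = 0" for i
    by (simp add: vec_eq_iff cvec_def)
  have "(\<Sum>k<CARD('n). Re (coeff q k) *\<^sub>R ((*v) M ^^ k) u) = 0"
    using arg_cong[OF *, of Re] by (simp add: vec_eq_iff Re_sum)
  moreover have "(\<Sum>k<CARD('n). Im (coeff q k) *\<^sub>R ((*v) M ^^ k) u) = 0"
    using arg_cong[OF *, of Im] by (simp add: vec_eq_iff Im_sum)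
  ultimately have "coeff q k = 0" if "k < CARD('n)" for k
    using krylov_basis(2)[OF matrix_vector_mul_linear cyclic_funpow[OF assms(1)], of "\<lambda>k. Re (coeff q k)" k]
      krylov_basis(2)[OF matrix_vector_mul_linear cyclic_funpow[OF assms(1)], of "\<lambda>k. Im (coeff q k)" k] that
    by (simp add: complex_eq_iff)
  then show ?thesis
    using assms(2) leading_coeff_neq_0 by blast
qed

text \<open>Expressing \<open>v d\<close> through the earlier iterates gives a monic
  \<open>p\<close> of degree \<open>d\<close> that annihilates \<open>u\<close>. Removing one linear
  factor leaves a polynomial of degree below \<open>d\<close>; by cyclicity it does not annihilate
  \<open>u\<close>, so it produces an eigenvector. The constant term of \<open>p\<close> is found
  from the companion matrix.\<close>

proposition cyclic_spectral_factorization: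
  fixes M :: "real^'n^'n"
  assumes cyc: "cyclic M u"
  obtains Z where "size Z = CARD('n)" "\<And>z. z \<in># Z \<Longrightarrow> eigenvalue M z"
    "\<bar>det M\<bar> = (\<Prod>z\<in>#Z. cmod z)" "poly_orbit M u (\<Prod>z\<in>#Z. [:-z, 1:]) = 0"
proof -
  define d where "d = CARD('n)"
  have "d > 0" by (simp add: d_def)
  define v where "v k = ((*v) M ^^ k) u" for k
  note span = cyclic_funpow[OF cyc]
  have lin: "linear ((*v) M)" by (rule matrix_vector_mul_linear)
  have "v d \<in> span (v ` {..<d})"
    using krylov_basis(1)[OF lin span] by (simp add: v_def[abs_def] d_def)
  then obtain c where c: "v d = (\<Sum>k<d. c k *\<^sub>R v k)"
    using in_span_image_sum[of "{..<d}"] by blast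
  obtain h :: "'n \<Rightarrow> nat" where "bij_betw h UNIV {0..<CARD('n)}"
    using ex_bij_betw_finite_nat[of "UNIV :: 'n set"] by auto
  then have det: "\<bar>det M\<bar> = \<bar>c 0\<bar>"
    using abs_det_companion[OF lin _ span, of h c] c by (simp add: lessThan_atLeast0 v_def d_def)
  define r where "r = (\<Sum>k<d. monom (complex_of_real (c k)) k)"
  define p where "p = monom 1 d - r"
  have coeff_r: "coeff r k = (if k < d then of_real (c k) else 0)" for k
    by (simp add: r_def coeff_sum sum.delta' cong: if_cong)
  have deg: "degree p = d"
  proof (rule antisym)
    show "degree p \<le> d"
      by (rule degree_le) (simp add: p_def coeff_r)
    show "d \<le> degree p"
      by (rule le_degree) (simp add: p_def coeff_r)
  qed
  then have "lead_coeff p = 1" by (simp add: p_def coeff_r)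
  then obtain Z where Z: "size Z = d" "p = (\<Prod>z\<in>#Z. [:-z, 1:])"
    using alg_closed_imp_factorization[of p] deg by fastforce
  have p_orbit: "poly_orbit M u p = 0"
  proof -
    have "poly_orbit M u p = (\<Sum>k<d. coeff p k *s cvec (v k)) + coeff p d *s cvec (v d)"
      by (simp add: poly_orbit_def deg v_def lessThan_Suc_atMost[symmetric])
    also have "\<dots> = 0"
      by (simp add: p_def coeff_r c cvec_def vec_eq_iff sum_negf)
    finally show ?thesis .
  qed
  have "eigenvalue M z" if z: "z \<in># Z" for z
  proof -
    define q where "q = (\<Prod>z\<in>#Z - {#z#}. [:-z, 1:])"
    have p_eq: "p = [:-z, 1:] * q"
      unfolding Z(2) q_def using z by (subst insert_DiffM[OF z, symmetric]) (simp only: prod_mset.add_mset image_mset_add_mset)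
    have "p \<noteq> 0" using \<open>lead_coeff p = 1\<close> by auto
    then have "q \<noteq> 0" using p_eq by auto
    then have "degree q < d" using deg p_eq degree_mult_eq[of "[:-z, 1:]" q] by simp
    then have "poly_orbit M u q \<noteq> 0"
      using poly_orbit_eq_0[OF cyc] \<open>q \<noteq> 0\<close> by (auto simp: d_def)
    moreover have "cmat M *v poly_orbit M u q = z *s poly_orbit M u q"
      using p_orbit unfolding p_eq poly_orbit_linear_factor by simp
    ultimately show ?thesis unfolding eigenvalue_def by blast
  qed
  moreover have "\<bar>det M\<bar> = (\<Prod>z\<in>#Z. cmod z)"
  proof -
    have "coeff p 0 = - of_real (c 0)" using \<open>d > 0\<close> by (simp add: p_def coeff_r)
    then have "\<bar>det M\<bar> = cmod (poly p 0)" by (simp add: det poly_0_coeff_0)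
    also have "poly p 0 = (\<Prod>z\<in>#Z. - z)"
      unfolding Z(2) by (simp add: poly_prod_mset)
    also have "cmod \<dots> = (\<Prod>z\<in>#Z. cmod z)"
      by (induction Z) (simp_all add: norm_mult)
    finally show ?thesis .
  qed
  ultimately show ?thesis
    using that Z p_orbit by (simp add: d_def)
qed

text \<open>Removing all factors of the annihilating polynomial leads from the zero orbit to the
  orbit of \<open>u\<close>. The vectors with summable orbits form a subspace containing the
  iterates of \<open>u\<close>, hence everything.\<close>

proposition summable_norm_matrix_funpow:
  fixes M :: "real^'n^'n"
  assumes cyc: "cyclic M u" and eig: "\<And>z. eigenvalue M z \<Longrightarrow> cmod z < 1"
  shows "summable (\<lambda>k. norm (((*v) M ^^ k) x))"
proof -
  obtain Z where Z: "\<And>z. z \<in># Z \<Longrightarrow> eigenvalue M z" "poly_orbit M u (\<Prod>z\<in>#Z. [:-z, 1:]) = 0"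
    using cyclic_spectral_factorization[OF cyc] by metis
  have "((*v) (cmat M) ^^ k) 0 = 0" for k by (induction k) simp_all
  then have "summable (\<lambda>k. norm (((*v) (cmat M) ^^ k) (poly_orbit M u 1)))"
    by (intro summable_poly_orbit[of Z M u 1, OF eig[OF Z(1)]]) (simp_all add: Z(2))
  moreover have "poly_orbit M u 1 = cvec u" by (simp add: poly_orbit_def)
  ultimately have u: "summable (\<lambda>k. norm (((*v) M ^^ k) u))"
    by (simp add: funpow_cmat_cvec norm_cvec)
  define S where "S = {x. summable (\<lambda>k. norm (((*v) M ^^ k) x))}"
  have lin: "linear ((*v) M ^^ k)" for k
    by (induction k) (auto simp: linear_iff algebra_simps)
  have "subspace S"
  proof (rule subspaceI)
    show "0 \<in> S" by (simp add: S_def linear_0[OF lin])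
    fix x y
    assume "x \<in> S" "y \<in> S"
    then have "summable (\<lambda>k. norm (((*v) M ^^ k) x) + norm (((*v) M ^^ k) y))"
      by (simp add: S_def summable_add)
    then show "x + y \<in> S"
      unfolding S_def mem_Collect_eq
      by (rule summable_comparison_test') (simp add: linear_add[OF lin] norm_triangle_ineq)
  next
    fix c x
    assume "x \<in> S"
    then show "c *\<^sub>R x \<in> S"
      by (simp add: S_def linear_scale[OF lin] summable_mult)
  qed
  moreover have "range (\<lambda>k. ((*v) M ^^ k) u) \<subseteq> S"
    using summable_ignore_initial_segment[OF u] by (auto simp: S_def funpow_add)
  ultimately have "span (range (\<lambda>k. ((*v) M ^^ k) u)) \<subseteq> S"
    by (rule span_minimal[rotated])
  then show ?thesis using cyclic_funpow[OF cyc] by (auto simp: S_def)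
qed

section \<open>Interior of the attractor\<close>

lemma det_matrix_funpow:
  fixes f :: "real^'n \<Rightarrow> real^'n"
  assumes "linear f"
  shows "det (matrix (f ^^ k)) = det (matrix f) ^ k"
proof (induction k)
  case 0
  then show ?case using matrix_id by (simp add: id_def)
next
  case (Suc k)
  have "matrix (f ^^ Suc k) = matrix f ** matrix (f ^^ k)"
    using matrix_compose[OF linear_funpow[OF assms] assms] by simp
  then show ?case by (simp add: det_mul Suc del: funpow.simps)
qed

theorem interior_signed_series:
  fixes f :: "real^'n \<Rightarrow> real^'n"
  assumes f: "linear f" and cyc: "span (range (\<lambda>k. (f ^^ k) u)) = UNIV"
    and sm: "\<And>x. summable (\<lambda>k. norm ((f ^^ k) x))"
    and det: "\<bar>det (matrix f)\<bar> ^ CARD('n) \<ge> 1 / 2"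
  shows "interior {(\<Sum>k. a k *\<^sub>R (f ^^ k) u) | a :: nat \<Rightarrow> real. \<forall>k. a k \<in> {-1, 1}} \<noteq> {}"
proof -
  define d where "d = CARD('n)"
  have "d > 0" by (simp add: d_def)
  define T where "T = f ^^ d"
  have T: "linear T" unfolding T_def using f by (rule linear_funpow)
  have det_T: "\<bar>det (matrix T)\<bar> \<ge> 1 / 2"
    using det by (simp add: T_def det_matrix_funpow[OF f] power_abs d_def)
  have sm_T: "summable (\<lambda>k. norm ((T ^^ k) x))" for x
    using summable_reindex[OF sm, of "\<lambda>k. d * k" x] \<open>d > 0\<close>
    by (simp add: T_def funpow_mult inj_on_def o_def)
  obtain C where C: "compact C" "convex C" "C \<noteq> {}" "ifs T u C \<subseteq> interior C"
    using absorbing_set[OF T sm_T] by blast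
  define D where "D n = (ifs T u ^^ n) C" for n
  have D_path: "path_connected (D n)" for n
    unfolding D_def
    using C by (intro ifs_funpow_path_connected T det_T convex_imp_path_connected)
  have D_sub: "D n \<subseteq> C" for n
  proof (induction n)
    case (Suc n)
    then have "D (Suc n) \<subseteq> ifs T u C" by (simp add: D_def ifs_mono)
    then show ?case using C(4) interior_subset by blast
  qed (simp add: D_def)
  have D_ne: "D n \<noteq> {}" for n
    by (induction n) (use C(3) in \<open>auto simp: D_def ifs_def\<close>)

  obtain h :: "'n \<Rightarrow> nat" where h: "bij_betw h UNIV {..<d}"
    using ex_bij_betw_finite_nat[of "UNIV :: 'n set"] by (auto simp: d_def lessThan_atLeast0)
  define h' where "h' = inv_into UNIV h"
  have h': "h' (h i) = i" for i
    using h by (auto simp: h'_def bij_betw_def)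
  have h_less: "h i < d" for i
    using h by (auto simp: bij_betw_def)
  \<comment> \<open>The images under \<open>f ^^ h i\<close> of the displacement
    \<open>2 *\<^sub>R u\<close> from \<open>T q - u\<close> to \<open>T q + u\<close>; up to the
    factor 2 they are the first \<open>d\<close> iterates of \<open>u\<close>.\<close>
  define e where "e i = 2 *\<^sub>R (f ^^ h i) u" for i
  have inj: "inj (\<lambda>x::real^'n. \<Sum>i\<in>UNIV. x $ i *\<^sub>R e i)"
  proof (rule injI)
    fix x y :: "real^'n"
    assume "(\<Sum>i\<in>UNIV. x $ i *\<^sub>R e i) = (\<Sum>i\<in>UNIV. y $ i *\<^sub>R e i)"
    then have "0 = (\<Sum>i\<in>UNIV. (2 * (x - y) $ h' (h i)) *\<^sub>R (f ^^ h i) u)"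
      by (simp add: e_def h' scaleR_diff_left sum_subtractf right_diff_distrib mult.commute)
    also have "\<dots> = (\<Sum>k<d. (2 * (x - y) $ h' k) *\<^sub>R (f ^^ k) u)"
      by (rule sum.reindex_bij_betw[OF h])
    finally have "2 * (x - y) $ h' k = 0" if "k < d" for k
      using krylov_basis(2)[OF f cyc, of "\<lambda>k. 2 * (x - y) $ h' k" k] that by (simp add: d_def)
    from this[OF h_less] show "x = y" by (simp add: vec_eq_iff h')
  qed
  have cont_f: "continuous_on S (f ^^ k)" for S k
    using linear_funpow[OF f] by (simp add: linear_continuous_on linear_conv_bounded_linear)
  \<comment> \<open>All \<open>D n\<close> lie in \<open>C\<close>, so one bound \<open>B\<close>,
    and with it one range \<open>N\<close> of lattice coefficients, serves every \<open>n\<close>.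
    The finite set \<open>P\<close> is thus fixed before \<open>\<delta>\<close> and
    \<open>n\<close>.\<close>
  have "bounded (\<Union>i. (f ^^ h i) ` C)"
    using C(1) by (intro bounded_UN ballI compact_imp_bounded compact_continuous_image cont_f) auto
  then obtain B where B: "B > 0" "\<And>i x. x \<in> C \<Longrightarrow> norm ((f ^^ h i) x) \<le> B"
    unfolding bounded_pos by blast
  obtain N :: int where cover:
    "\<And>g y. \<lbrakk>\<And>i. path (g i); \<And>i. path_image (g i) \<subseteq> cball 0 B;
        \<And>i. pathfinish (g i) = pathstart (g i) + e i; norm y \<le> 1\<rbrakk>
      \<Longrightarrow> \<exists>m p. (\<forall>i. m i \<in> {-N..N}) \<and> (\<forall>i. p i \<in> path_image (g i)) \<and>
            y = (\<Sum>i\<in>UNIV. p i) + (\<Sum>i\<in>UNIV. of_int (m i) *\<^sub>R e i)"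
    using lattice_translates_of_path_sums_cover[OF inj less_imp_le[OF B(1)]] by blast

  define A where "A = {(\<Sum>k. a k *\<^sub>R (f ^^ k) u) | a :: nat \<Rightarrow> real. \<forall>k. a k \<in> {-1, 1}}"
  define P where "P = (\<lambda>m. \<Sum>i\<in>UNIV. of_int (m i) *\<^sub>R e i) ` PiE UNIV (\<lambda>_. {-N..N})"
  have "interior A \<noteq> {}"
  proof (rule interior_nonempty_if_translates_dense_in_ball)
    show "closed A"
      unfolding A_def using sm by (intro compact_imp_closed compact_signed_series)
    show "finite P"
      unfolding P_def by (intro finite_imageI finite_PiE) auto
    fix \<delta> :: real and y :: "real^'n"
    assume "\<delta> > 0" and y: "norm y \<le> 1"
    \<comment> \<open>The condition \<open>n \<ge> 1\<close> makes \<open>D n\<close> an image under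
      \<open>ifs\<close>, which supplies two points differing by
      \<open>2 *\<^sub>R u\<close>.\<close>
    have "\<forall>\<^sub>F n in sequentially. n \<ge> 1 \<and> (\<forall>x. (\<forall>j<d. x j \<in> D n) \<longrightarrow>
      (\<exists>a :: nat \<Rightarrow> real. (\<forall>k. a k \<in> {-1, 1}) \<and>
        norm ((\<Sum>j<d. (f ^^ j) (x j)) - (\<Sum>k. a k *\<^sub>R (f ^^ k) u)) \<le> \<delta>))"
      unfolding D_def T_def
      using ifs_funpow_near_signed_series[OF f sm \<open>d > 0\<close> compact_imp_bounded[OF C(1)] \<open>\<delta> > 0\<close>]
      by (intro eventually_conj eventually_ge_at_top)
    then obtain n where n: "n \<ge> 1" and near: "\<And>x. (\<forall>j<d. x j \<in> D n) \<Longrightarrow>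
      \<exists>a :: nat \<Rightarrow> real. (\<forall>k. a k \<in> {-1, 1}) \<and>
        norm ((\<Sum>j<d. (f ^^ j) (x j)) - (\<Sum>k. a k *\<^sub>R (f ^^ k) u)) \<le> \<delta>"
      unfolding eventually_sequentially by blast
    obtain q where q: "q \<in> D (n - 1)" using D_ne by blast
    have "D n = ifs T u (D (n - 1))" using n by (cases n) (simp_all add: D_def)
    then have "T q - u \<in> D n" "T q + u \<in> D n" using q by (auto simp: ifs_def)
    then obtain g where g: "path g" "path_image g \<subseteq> D n" "pathstart g = T q - u" "pathfinish g = T q + u"
      using D_path[of n] unfolding path_connected_def by blast
    have "\<exists>m p. (\<forall>i. m i \<in> {-N..N}) \<and> (\<forall>i. p i \<in> path_image ((f ^^ h i) \<circ> g)) \<and>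
        y = (\<Sum>i\<in>UNIV. p i) + (\<Sum>i\<in>UNIV. of_int (m i) *\<^sub>R e i)"
    proof (rule cover[OF _ _ _ y])
      show "path ((f ^^ h i) \<circ> g)" for i
        using g(1) cont_f by (rule path_continuous_image)
      show "path_image ((f ^^ h i) \<circ> g) \<subseteq> cball 0 B" for i
        using g(2) D_sub[of n] B(2) unfolding path_image_compose by force
      show "pathfinish ((f ^^ h i) \<circ> g) = pathstart ((f ^^ h i) \<circ> g) + e i" for i
        using linear_funpow[OF f, of "h i"]
        by (simp add: pathfinish_compose pathstart_compose g linear_add linear_diff e_def scaleR_2)
    qed
    then obtain m p where m: "\<And>i. m i \<in> {-N..N}" and p: "\<And>i. p i \<in> path_image ((f ^^ h i) \<circ> g)"
      and y_eq: "y = (\<Sum>i\<in>UNIV. p i) + (\<Sum>i\<in>UNIV. of_int (m i) *\<^sub>R e i)" by blast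
    have "\<forall>i. \<exists>x. x \<in> D n \<and> p i = (f ^^ h i) x"
      using p g(2) by (fastforce simp: path_image_compose)
    from choice[OF this] obtain x where x: "\<And>i. x i \<in> D n" "\<And>i. p i = (f ^^ h i) (x i)"
      by blast
    obtain a :: "nat \<Rightarrow> real" where a: "\<forall>k. a k \<in> {-1, 1}"
      "norm ((\<Sum>j<d. (f ^^ j) (x (h' j))) - (\<Sum>k. a k *\<^sub>R (f ^^ k) u)) \<le> \<delta>"
      using near[of "\<lambda>j. x (h' j)"] x(1) by blast
    have "(\<Sum>i\<in>UNIV. p i) = (\<Sum>j<d. (f ^^ j) (x (h' j)))"
      using sum.reindex_bij_betw[OF h, of "\<lambda>j. (f ^^ j) (x (h' j))"] by (simp add: x(2) h')
    then have "dist ((\<Sum>i\<in>UNIV. of_int (m i) *\<^sub>R e i) + (\<Sum>k. a k *\<^sub>R (f ^^ k) u)) y \<le> \<delta>"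
      using a(2) by (simp add: y_eq dist_norm norm_minus_commute algebra_simps)
    moreover have "(\<Sum>i\<in>UNIV. of_int (m i) *\<^sub>R e i) \<in> P"
      unfolding P_def using m by (intro imageI) (simp add: PiE_iff)
    moreover have "(\<Sum>k. a k *\<^sub>R (f ^^ k) u) \<in> A"
      unfolding A_def using a(1) by blast
    ultimately show "\<exists>v\<in>P. \<exists>a\<in>A. dist (v + a) y \<le> \<delta>" by blast
  qed
  then show ?thesis by (simp add: A_def)
qed

lemma power_size_le_prod_mset:
  fixes r :: real
  assumes "0 \<le> r" "\<And>z. z \<in># Z \<Longrightarrow> r \<le> g z"
  shows "r ^ size Z \<le> (\<Prod>z\<in>#Z. g z)"
  using assms(2)
proof (induction Z)
  case (add z Z)
  then have "r ^ size Z \<le> (\<Prod>z\<in>#Z. g z)" "r \<le> g z" by auto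
  then have "r * r ^ size Z \<le> g z * (\<Prod>z\<in>#Z. g z)"
    using assms(1) by (intro mult_mono) auto
  then show ?case by simp
qed simp

theorem theorem1p1:
  fixes M :: "real^'n^'n" and u :: "real^'n"
  assumes "CARD('n) \<ge> 2"
    and "\<And>z. eigenvalue M z \<Longrightarrow> cmod z < 1"
    and "cyclic M u"
  shows "(\<bar>det M\<bar> \<ge> 2 powr (- 1 / real CARD('n)) \<longrightarrow> interior (attractor M u) \<noteq> {}) \<and>
         ((\<forall>z. eigenvalue M z \<longrightarrow> cmod z > 2 powr (- 1 / (real CARD('n))\<^sup>2)) \<longrightarrow>
            interior (attractor M u) \<noteq> {})"
proof -
  define d where "d = CARD('n)"
  have d: "d \<ge> 2" using assms(1) by (simp add: d_def)
  have det: "interior (attractor M u) \<noteq> {}" if "\<bar>det M\<bar> \<ge> 2 powr (- 1 / real d)"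
  proof -
    have "1 / 2 = (2 powr (- 1 / real d)) powr real d"
      unfolding powr_powr using d by (simp add: powr_neg_one)
    also have "\<dots> = (2 powr (- 1 / real d)) ^ d"
      by (rule powr_realpow) simp
    also have "\<dots> \<le> \<bar>det M\<bar> ^ d" using that by (intro power_mono) auto
    finally have "interior {(\<Sum>k. a k *\<^sub>R ((*v) M ^^ k) u) | a :: nat \<Rightarrow> real. \<forall>k. a k \<in> {-1, 1}} \<noteq> {}"
      by (intro interior_signed_series cyclic_funpow summable_norm_matrix_funpow[OF assms(3,2)] assms(3))
         (simp_all add: d_def)
    then show ?thesis by (simp add: attractor_def orbit_def)
  qed
  moreover have "\<bar>det M\<bar> \<ge> 2 powr (- 1 / real d)"
    if eig: "\<forall>z. eigenvalue M z \<longrightarrow> cmod z > 2 powr (- 1 / (real d)\<^sup>2)"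
  proof -
    obtain Z where Z: "size Z = d" "\<And>z. z \<in># Z \<Longrightarrow> eigenvalue M z" "\<bar>det M\<bar> = (\<Prod>z\<in>#Z. cmod z)"
      using cyclic_spectral_factorization[OF assms(3)] unfolding d_def by metis
    \<comment> \<open>The bound on each of the \<open>d\<close> factors is the \<open>d\<close>-th
      root of \<open>2 powr (- 1 / real d)\<close>.\<close>
    have "2 powr (- 1 / real d) = (2 powr (- 1 / (real d)\<^sup>2)) ^ size Z"
      using d by (simp add: Z(1) powr_realpow[symmetric] powr_powr power2_eq_square)
    also have "\<dots> \<le> (\<Prod>z\<in>#Z. cmod z)"
      using eig Z(2) by (intro power_size_le_prod_mset) (auto intro: less_imp_le)
    finally show ?thesis by (simp add: Z(3))
  qed
  ultimately show ?thesis unfolding d_def by blast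
qed

end
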